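(* Let $n\ge1$, let $P\in\mathbb{C}[X_1^{\pm1},\ldots,X_n^{\pm1}]\setminus\{0\}$ have $k\ge2$ non-zero terms, and let $\epsilon>0$. For $a=(a_1,\ldots,a_n)\in\mathbb{Z}^n$ we have \[ m\bigl(P(X^{a_1},\ldots,X^{a_n})\bigr)=m(P)+O\!\left(\rho(a;\mathbb{Z}^n)^{-\frac{1}{4(k-1)}+\epsilon}\right) \] as $\rho(a;\mathbb{Z}^n)\to\infty$, where the implied constant depends on $n$, $P$ and $\epsilon$.
   Context: $m(Q)=\int_{[0,1]^r}\log|Q(e^{2\pi\sqrt{-1}x_1},\ldots,e^{2\pi\sqrt{-1}x_r})|\,dx$ denotes the logarithmic Mahler measure of a non-zero Laurent polynomial $Q$ in $r$ variables. $\rho(a;\mathbb{Z}^n)=\inf\{|\omega|:\omega\in\mathbb{Z}^n\setminus\{0\},\ \langle\omega,a\rangle=0\}$, where $|\cdot|$ is the supremum norm and $\langle\cdot,\cdot\rangle$ the standard scalar product. *)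

theory Defs
  imports "HOL-Analysis.Analysis" "HOL-Library.Poly_Mapping"
begin

text \<open>The Laurent polynomial ring over the complex numbers in the variables \<open>X\<^sub>i\<close>, \<open>i :: 'n\<close>, is the
  monoid algebra of the exponent group \<open>\<int>\<^sup>n\<close>.  The non-zero terms of \<open>P\<close> correspond to \<open>keys P\<close>.\<close>

type_synonym 'n laurent = "(int ^ 'n) \<Rightarrow>\<^sub>0 complex"

definition laurent_eval :: "'n::finite laurent \<Rightarrow> complex ^ 'n \<Rightarrow> complex" where
  "laurent_eval P z =
     (\<Sum>\<omega>\<in>Poly_Mapping.keys P. Poly_Mapping.lookup P \<omega> * (\<Prod>i\<in>UNIV. (z $ i) powi (\<omega> $ i)))"

definition torus_pt :: "real ^ 'n::finite \<Rightarrow> complex ^ 'n" where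
  "torus_pt x = (\<chi> i. exp (2 * complex_of_real pi * \<i> * complex_of_real (x $ i)))"

text \<open>The integrand takes the junk value \<open>ln 0 = 0\<close> at the zeros of \<open>Q\<close> on the torus; for \<open>Q \<noteq> 0\<close>
  these form a null set.\<close>

definition mahler :: "'r::finite laurent \<Rightarrow> real" where
  "mahler Q = (LINT x:cbox 0 1|lborel. ln (cmod (laurent_eval Q (torus_pt x))))"

definition int_dot :: "int ^ 'n::finite \<Rightarrow> int ^ 'n \<Rightarrow> int" where
  "int_dot \<omega> a = (\<Sum>i\<in>UNIV. \<omega> $ i * a $ i)"

definition int_supnorm :: "int ^ 'n::finite \<Rightarrow> int" where
  "int_supnorm \<omega> = Max (range (\<lambda>i. \<bar>\<omega> $ i\<bar>))"

text \<open>The univariate Laurent polynomial \<open>P(X\<^bsup>a\<^sub>1\<^esup>, \<dots>, X\<^bsup>a\<^sub>n\<^esup>)\<close>; terms of \<open>P\<close> with the same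
  image exponent are added up.\<close>

definition monomial_subst :: "int ^ 'n::finite \<Rightarrow> 'n laurent \<Rightarrow> 1 laurent" where
  "monomial_subst a P =
     (\<Sum>\<omega>\<in>Poly_Mapping.keys P.
        Poly_Mapping.single (\<chi> _. int_dot \<omega> a) (Poly_Mapping.lookup P \<omega>))"

text \<open>The infimum is \<open>\<infinity>\<close> if \<open>a\<close> has no non-zero integral relation, i.e. if \<open>n = 1\<close> and \<open>a \<noteq> 0\<close>.\<close>

definition rho :: "int ^ 'n::finite \<Rightarrow> ereal" where
  "rho a = (INF \<omega>\<in>{\<omega>. \<omega> \<noteq> 0 \<and> int_dot \<omega> a = 0}. ereal (of_int (int_supnorm \<omega>)))"

text \<open>Real powers on \<open>[0, \<infinity>]\<close>, the value at \<open>\<infinity>\<close> being the limit of \<open>x powr s\<close> as \<open>x\<close> tends to \<open>\<infinity>\<close>;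
  the value at \<open>-\<infinity>\<close> is arbitrary.\<close>

definition ereal_powr :: "ereal \<Rightarrow> real \<Rightarrow> ereal" where
  "ereal_powr x s =
     (case x of
        ereal r \<Rightarrow> ereal (r powr s)
      | PInfty \<Rightarrow> (if s < 0 then 0 else if s = 0 then 1 else \<infinity>)
      | MInfty \<Rightarrow> 0)"

lemma laurent_eval_superset:
  assumes "finite A" "Poly_Mapping.keys P \<subseteq> A"
  shows "laurent_eval P z =
    (\<Sum>\<omega>\<in>A. Poly_Mapping.lookup P \<omega> * (\<Prod>i\<in>UNIV. (z $ i) powi (\<omega> $ i)))"
  unfolding laurent_eval_def using assms
  by (intro sum.mono_neutral_left) (auto simp: in_keys_iff)

lemma laurent_eval_add: "laurent_eval (P + Q) z = laurent_eval P z + laurent_eval Q z"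
proof -
  let ?A = "Poly_Mapping.keys P \<union> Poly_Mapping.keys Q"
  have "Poly_Mapping.keys (P + Q) \<subseteq> ?A"
    by (rule Poly_Mapping.keys_add)
  then show ?thesis
    by (simp add: laurent_eval_superset[where A = ?A] lookup_add algebra_simps sum.distrib)
qed

lemma laurent_eval_zero: "laurent_eval 0 z = 0"
  by (simp add: laurent_eval_def)

lemma laurent_eval_sum: "laurent_eval (\<Sum>j\<in>J. P j) z = (\<Sum>j\<in>J. laurent_eval (P j) z)"
  by (induction J rule: infinite_finite_induct) (auto simp: laurent_eval_add laurent_eval_zero)

lemma laurent_eval_single:
  "laurent_eval (Poly_Mapping.single \<omega> c) z = c * (\<Prod>i\<in>UNIV. (z $ i) powi (\<omega> $ i))"
  by (simp add: laurent_eval_superset[where A = "{\<omega>}"])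

lemma power_int_sum:
  fixes w :: "'a::field"
  assumes "w \<noteq> 0" "finite J"
  shows "w powi (\<Sum>j\<in>J. f j) = (\<Prod>j\<in>J. w powi f j)"
  using assms(2) by induction (auto simp: power_int_add assms(1))

lemma laurent_eval_monomial_subst:
  assumes "w \<noteq> 0"
  shows "laurent_eval (monomial_subst a P) (\<chi> _. w) = laurent_eval P (\<chi> i. w powi (a $ i))"
  unfolding monomial_subst_def laurent_eval_sum laurent_eval_single laurent_eval_def[of P]
  using assms by (simp add: int_dot_def power_int_sum mult.commute flip: power_int_mult)

end

theory Submission
  imports Defs
begin

text \<open>
  Let \<open>L\<close> be the sum of the absolute values of the coefficients of \<open>P\<close>, so that
  \<open>h = |P|\<^sup>2 / L\<^sup>2\<close> takes values in \<open>[0, 1]\<close> on the torus and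
  \<open>log h = - (\<Sum>j\<ge>1. (1 - h)\<^sup>j / j)\<close>.  The function \<open>(1 - h)\<^sup>j\<close> is a trigonometric polynomial
  whose frequencies have supremum norm \<open>O(j)\<close>, hence its integral over the torus agrees
  \<^emph>\<open>exactly\<close> with its integral along \<open>t \<mapsto> (a\<^sub>1 t, \<dots>, a\<^sub>n t)\<close> as long as \<open>j\<close> is less than a constant
  multiple of \<open>\<rho>(a)\<close>.  For the remaining \<open>j\<close> both integrals are small: by Lawton's bound an
  exponential sum with \<open>k\<close> terms satisfies \<open>|Q| \<le> s\<close> only on a set of measure \<open>O(s\<^bsup>1/(k-1)\<^esup>)\<close>,
  uniformly in the exponents, and therefore both integrals are \<open>O(j\<^bsup>-1/(4(k-1))\<^esup>)\<close>.  The torus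
  integral inherits this bound from a line integral with sufficiently large \<open>\<rho>(a)\<close>, so no estimate
  in several variables is needed.
\<close>

subsection \<open>Sublevel sets of exponential sums\<close>

text \<open>Without interior zeros \<open>g'\<close> has constant sign on \<open>{a..b}\<close>, so
  the integral of \<open>\<bar>g' x\<bar>\<close> between two points of the set is the difference of
  the values of \<open>g\<close> there, at most \<open>2 * t\<close>. It is at least
  \<open>\<tau>\<close> times the measure of the set, since
  \<open>\<tau> \<le> \<bar>g' x\<bar>\<close> on it.\<close>

lemma sublevel_measure_monotone:
  fixes g g' :: "real \<Rightarrow> real"
  assumes deriv: "\<And>x. (g has_real_derivative g' x) (at x)"
    and cont: "continuous_on UNIV g'"
    and nz: "\<And>x. a < x \<Longrightarrow> x < b \<Longrightarrow> g' x \<noteq> 0"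
    and "\<tau> > 0" "t \<ge> 0"
  shows "measure lborel {x\<in>{a..b}. \<bar>g x\<bar> \<le> t \<and> \<tau> \<le> \<bar>g' x\<bar>} \<le> 2 * t / \<tau>"
proof -
  define S where "S = {x\<in>{a..b}. \<bar>g x\<bar> \<le> t \<and> \<tau> \<le> \<bar>g' x\<bar>}"
  have contg: "continuous_on UNIV g"
    using deriv by (meson DERIV_continuous continuous_at_imp_continuous_on)
  have "closed {x. \<bar>g x\<bar> \<le> t}" "closed {x. \<tau> \<le> \<bar>g' x\<bar>}"
    by (intro closed_Collect_le continuous_intros contg cont)+
  moreover have "S = {a..b} \<inter> ({x. \<bar>g x\<bar> \<le> t} \<inter> {x. \<tau> \<le> \<bar>g' x\<bar>})"
    by (auto simp: S_def)
  ultimately have compS: "compact S"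
    by (metis closed_Int compact_Icc compact_Int_closed)
  have "measure lborel S \<le> 2 * t / \<tau>"
  proof (cases "S = {}")
    case True
    then show ?thesis using assms by simp
  next
    case False
    obtain c where c: "c \<in> S" "\<And>x. x \<in> S \<Longrightarrow> c \<le> x"
      using compact_attains_inf[OF compS False] by blast
    obtain d where d: "d \<in> S" "\<And>x. x \<in> S \<Longrightarrow> x \<le> d"
      using compact_attains_sup[OF compS False] by blast
    have "c \<le> d" using c d by blast
    \<comment> \<open>Zeros of \<open>g'\<close> at \<open>a\<close> and \<open>b\<close> are
      allowed, but a zero produced by a change of sign lies strictly between \<open>x\<close> and
      \<open>y\<close> and hence inside the open interval.\<close>
    have no_change: False if "x \<in> {a..b}" "y \<in> {a..b}" "g' x < 0" "0 < g' y" for x y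
    proof -
      have *: "continuous_on A g'" for A
        using cont continuous_on_subset by blast
      have "x \<noteq> y" using that by auto
      then consider "x < y" | "y < x" by linarith
      then have "\<exists>z. min x y \<le> z \<and> z \<le> max x y \<and> g' z = 0"
      proof cases
        case 1
        then show ?thesis
          using IVT'[of g' x 0 y, OF _ _ _ *] that(3,4) by auto
      next
        case 2
        then show ?thesis
          using IVT2'[of g' x 0 y, OF _ _ _ *] that(3,4) by auto
      qed
      then obtain z where "min x y \<le> z" "z \<le> max x y" "g' z = 0" by blast
      moreover from this have "z \<noteq> x" "z \<noteq> y" using that by auto
      ultimately show False
        using nz[of z] that(1,2) by (auto simp: min_def max_def split: if_splits)
    qed
    define \<sigma> :: real where "\<sigma> = (if \<forall>x\<in>{a..b}. 0 \<le> g' x then 1 else -1)"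
    have \<sigma>: "\<sigma> * g' x = \<bar>g' x\<bar>" if "x \<in> {a..b}" for x
    proof (cases "\<forall>x\<in>{a..b}. 0 \<le> g' x")
      case True
      then show ?thesis using that by (simp add: \<sigma>_def)
    next
      case False
      then obtain y where y: "y \<in> {a..b}" "g' y < 0" by force
      have "g' x \<le> 0"
        using no_change[OF y(1) that y(2)] by force
      then show ?thesis using False by (auto simp: \<sigma>_def)
    qed
    have cd: "{c..d} \<subseteq> {a..b}" using c d by (auto simp: S_def)
    have contc: "continuous_on {c..d} (\<lambda>x. \<sigma> * g' x)"
      by (intro continuous_intros continuous_on_subset[OF cont]) auto
    have int: "integral\<^sup>L lborel (\<lambda>x. indicator {c..d} x *\<^sub>R (\<sigma> * g' x)) = \<sigma> * g d - \<sigma> * g c"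
      using contc
      by (intro integral_FTC_atLeastAtMost \<open>c \<le> d\<close>)
        (auto intro!: DERIV_cmult has_field_derivative_at_within[OF deriv]
            simp flip: has_real_derivative_iff_has_vector_derivative)
    have "\<tau> * measure lborel S = integral\<^sup>L lborel (\<lambda>x. \<tau> * indicator S x)"
      by simp
    also have "\<dots> \<le> integral\<^sup>L lborel (\<lambda>x. indicator {c..d} x *\<^sub>R (\<sigma> * g' x))"
    proof (rule integral_mono)
      show "integrable lborel (\<lambda>x. \<tau> * indicator S x)"
        using emeasure_compact_finite[OF compS] borel_compact[OF compS]
        by (intro integrable_mult_right integrable_real_indicator)
          auto
      show "integrable lborel (\<lambda>x. indicator {c..d} x *\<^sub>R (\<sigma> * g' x))"
        using borel_integrable_compact[OF _ contc] by (simp add: indicator_scaleR_eq_if)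
      show "\<tau> * indicator S x \<le> indicator {c..d} x *\<^sub>R (\<sigma> * g' x)" for x
        using c d \<sigma>[of x] cd by (auto simp: indicator_def) (auto simp: S_def)
    qed
    also have "\<dots> \<le> \<bar>\<sigma> * g d - \<sigma> * g c\<bar>" using int by simp
    also have "\<dots> \<le> 2 * t"
      using c d by (auto simp: S_def \<sigma>_def)
    finally show ?thesis using \<open>\<tau> > 0\<close> by (simp add: field_simps)
  qed
  then show ?thesis by (simp add: S_def)
qed

text \<open>The interior critical points cut the interval into one more piece than their number, and
  the previous bound applies to each piece. The induction cuts at a single critical point
  \<open>z\<close>, which belongs to neither of the two open subintervals, so both counts
  drop.\<close>

lemma sublevel_measure_finite_critical:
  fixes g g' :: "real \<Rightarrow> real"
  assumes deriv: "\<And>x. (g has_real_derivative g' x) (at x)"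
    and cont: "continuous_on UNIV g'"
    and "finite {x\<in>{a<..<b}. g' x = 0}"
    and "\<tau> > 0" "t \<ge> 0"
  shows "measure lborel {x\<in>{a..b}. \<bar>g x\<bar> \<le> t \<and> \<tau> \<le> \<bar>g' x\<bar>}
    \<le> (card {x\<in>{a<..<b}. g' x = 0} + 1) * (2 * t / \<tau>)"
  using assms(3)
proof (induction "card {x\<in>{a<..<b}. g' x = 0}" arbitrary: a b rule: less_induct)
  case less
  let ?Z = "\<lambda>a b. {x\<in>{a<..<b}. g' x = 0}"
  let ?S = "\<lambda>a b. {x\<in>{a..b}. \<bar>g x\<bar> \<le> t \<and> \<tau> \<le> \<bar>g' x\<bar>}"
  show ?case
  proof (cases "?Z a b = {}")
    case True
    then have "measure lborel (?S a b) \<le> 2 * t / \<tau>"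
      using assms by (intro sublevel_measure_monotone) auto
    then show ?thesis unfolding True by simp
  next
    case False
    then obtain z where z: "a < z" "z < b" "g' z = 0" by auto
    have split: "?Z a b = insert z (?Z a z \<union> ?Z z b)" using z by force
    have fin: "finite (?Z a z)" "finite (?Z z b)"
      using less.prems unfolding split by auto
    have card: "card (?Z a b) = Suc (card (?Z a z) + card (?Z z b))"
      unfolding split using fin by (subst card_insert_disjoint; simp; subst card_Un_disjoint; force)
    have [measurable]: "g \<in> borel_measurable borel" "g' \<in> borel_measurable borel"
      using deriv cont
      by (auto intro!: borel_measurable_continuous_onI continuous_at_imp_continuous_on DERIV_isCont)
    have fm: "?S u v \<in> fmeasurable lborel" for u v
      by (rule fmeasurableI2[of "{u..v}"]) (auto intro!: fmeasurable_compact)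
    have "?S a b = ?S a z \<union> ?S z b" using z by auto
    then have "measure lborel (?S a b) \<le> measure lborel (?S a z) + measure lborel (?S z b)"
      using fm by (simp only: ) (intro measure_Un_le, auto)
    also have "\<dots> \<le> (card (?Z a z) + 1) * (2 * t / \<tau>) + (card (?Z z b) + 1) * (2 * t / \<tau>)"
      by (intro add_mono less.hyps fin) (use card in linarith)+
    also have "\<dots> = (card (?Z a b) + 1) * (2 * t / \<tau>)"
      unfolding card by (simp add: algebra_simps)
    finally show ?thesis .
  qed
qed

lemma cis_2pi_inj:
  assumes "cis (2 * pi * x) = cis (2 * pi * y)" "x \<in> {0<..<1}" "y \<in> {0<..<1}"
  shows "x = y"
proof -
  have "cis (2 * pi * x - 2 * pi * y) = 1"
    using assms(1) by (simp flip: cis_divide)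
  then have "\<exists>n. 2 * pi * x - 2 * pi * y = of_int n * 2 * pi"
    by (metis cos_one_2pi_int cis.sel(1) one_complex.sel(1))
  then obtain n where "2 * pi * x - 2 * pi * y = of_int n * 2 * pi" by blast
  then have "2 * pi * (x - y) = 2 * pi * of_int n" by (simp add: algebra_simps)
  then have "x - y = of_int n" by simp
  with assms(2,3) have "\<bar>real_of_int n\<bar> < 1" by auto
  then have "n = 0" by linarith
  with \<open>x - y = of_int n\<close> show ?thesis by simp
qed

text \<open>On the unit circle conjugation is inversion. Multiplication of \<open>2 * g x\<close> by
  the \<open>M\<close>-th power of \<open>cis (2 * pi * x)\<close> therefore gives an ordinary
  polynomial of degree at most \<open>2 * M\<close>, and distinct zeros in the open unit interval
  give distinct roots.\<close>

lemma real_trig_sum_zeros: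
  fixes d :: "'i \<Rightarrow> complex" and e :: "'i \<Rightarrow> nat"
  assumes "finite I" and deg: "\<And>i. i \<in> I \<Longrightarrow> e i \<le> M"
  defines "g \<equiv> \<lambda>x. Re (\<Sum>i\<in>I. d i * cis (2 * pi * of_nat (e i) * x))"
  shows "(\<forall>x. g x = 0) \<or>
    finite {x\<in>{0<..<1}. g x = 0} \<and> card {x\<in>{0<..<1}. g x = 0} \<le> 2 * M"
proof -
  \<comment> \<open>The shift by \<open>M\<close> makes room for the negative frequencies of the
    conjugate terms; \<open>M - e i\<close> is not truncated because
    \<open>e i \<le> M\<close>.\<close>
  define p where "p = (\<Sum>i\<in>I. monom (d i) (M + e i) + monom (cnj (d i)) (M - e i))"
  have p: "poly p (cis (2 * pi * x)) = cis (2 * pi * x) ^ M * of_real (2 * g x)" for x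
  proof -
    let ?z = "cis (2 * pi * x)"
    have pow: "?z ^ m = cis (2 * pi * of_nat m * x)" for m
      by (simp add: Complex.DeMoivre mult_ac)
    have "poly p ?z = (\<Sum>i\<in>I. ?z ^ M * (d i * ?z ^ e i + cnj (d i * ?z ^ e i)))"
    proof -
      have "?z ^ (M - e i) = ?z ^ M * cnj (?z ^ e i)" if "i \<in> I" for i
      proof -
        have "?z ^ M = ?z ^ (M - e i) * ?z ^ e i"
          using deg[OF that] by (simp flip: power_add)
        moreover have "?z ^ e i * cnj (?z ^ e i) = 1"
          by (simp add: pow cis_cnj cis_mult)
        ultimately show ?thesis by (simp add: mult.assoc)
      qed
      then show ?thesis
        by (simp add: p_def poly_sum poly_monom power_add algebra_simps)
    qed
    also have "\<dots> = ?z ^ M * of_real (\<Sum>i\<in>I. 2 * Re (d i * ?z ^ e i))"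
      by (simp only: complex_add_cnj sum_distrib_left of_real_sum)
    also have "(\<Sum>i\<in>I. 2 * Re (d i * ?z ^ e i)) = 2 * g x"
      by (simp only: pow g_def Re_sum sum_distrib_left)
    finally show ?thesis .
  qed
  have zero_iff: "g x = 0 \<longleftrightarrow> poly p (cis (2 * pi * x)) = 0" for x
    unfolding p by simp
  show ?thesis
  proof (cases "p = 0")
    case True
    then show ?thesis by (simp add: zero_iff)
  next
    case False
    let ?Z = "{x\<in>{0<..<1}. g x = 0}"
    have inj: "inj_on (\<lambda>x. cis (2 * pi * x)) ?Z"
      by (rule inj_onI, rule cis_2pi_inj) auto
    have sub: "(\<lambda>x. cis (2 * pi * x)) ` ?Z \<subseteq> {z. poly p z = 0}"
      using zero_iff by auto
    have fin: "finite {z. poly p z = 0}" using poly_roots_finite[OF False] .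
    have "card ?Z \<le> card {z. poly p z = 0}"
      using card_inj_on_le[OF inj sub fin] .
    also have "\<dots> \<le> degree p" using card_poly_roots_bound[OF False] .
    also have "\<dots> \<le> 2 * M"
      unfolding p_def using deg
      by (intro degree_sum_le \<open>finite I\<close> degree_add_le)
        (auto intro!: order.trans[OF degree_monom_le] simp: le_diff_conv trans_le_add1 add_mono mult_2)
    finally have "card ?Z \<le> 2 * M" .
    moreover have "finite ?Z" using finite_subset[OF sub fin] inj finite_imageD by blast
    ultimately show ?thesis by blast
  qed
qed

section \<open>Lawton's bound for exponential sums\<close>

definition expsum :: "'i set \<Rightarrow> ('i \<Rightarrow> complex) \<Rightarrow> ('i \<Rightarrow> int) \<Rightarrow> real \<Rightarrow> complex" where
  "expsum I c e x = (\<Sum>i\<in>I. c i * cis (2 * pi * of_int (e i) * x))"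

lemma continuous_on_expsum [continuous_intros]: "continuous_on S (expsum I c e)"
  unfolding expsum_def by (intro continuous_intros)

lemma borel_measurable_expsum [measurable]: "expsum I c e \<in> borel_measurable borel"
  by (intro borel_measurable_continuous_onI continuous_on_expsum)

text \<open>The number of critical points is at most \<open>2 M\<close>; this cancels against the factor \<open>M\<close> in the
  derivative, which is why the bound does not depend on the exponents.\<close>

lemma Re_sublevel_measure_expsum:
  fixes c :: "'i \<Rightarrow> complex" and e :: "'i \<Rightarrow> nat"
  assumes "finite I" and deg: "\<And>i. i \<in> I \<Longrightarrow> e i \<le> M" and "M \<ge> 1" "T > 0" "t \<ge> 0"
  defines "Q \<equiv> expsum I c e" and "Q' \<equiv> expsum I (\<lambda>i. 2 * pi * \<i> * e i * c i) e"
  shows "measure lborel {x\<in>{0..1}. \<bar>Re (Q x)\<bar> \<le> t \<and> pi * M * T \<le> \<bar>Re (Q' x)\<bar>} \<le> 2 * t / T"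
proof -
  have pos: "pi * M * T > 0" using assms by simp
  have deriv: "((\<lambda>x. Re (Q x)) has_real_derivative Re (Q' x)) (at x)" for x
  proof -
    have "(Q has_vector_derivative Q' x) (at x)"
      unfolding Q_def Q'_def expsum_def
      by (auto intro!: derivative_eq_intros sum.cong simp: has_vector_derivative_def
          sum_distrib_left scaleR_conv_of_real scaleR_sum_right mult_ac)
    then show ?thesis
      unfolding has_real_derivative_iff_has_vector_derivative
      by (rule bounded_linear.has_vector_derivative[OF bounded_linear_Re])
  qed
  have cont: "continuous_on UNIV (\<lambda>x. Re (Q' x))"
    unfolding Q'_def by (intro continuous_intros)
  consider "\<forall>x. Re (Q' x) = 0"
    | "finite {x\<in>{0<..<1}. Re (Q' x) = 0}" "card {x\<in>{0<..<1}. Re (Q' x) = 0} \<le> 2 * M"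
    using real_trig_sum_zeros[of I e M "\<lambda>i. 2 * pi * \<i> * e i * c i"] assms
    unfolding Q'_def expsum_def of_int_of_nat_eq by blast
  then show ?thesis
  proof cases
    case 1
    then have empty: "{x\<in>{0..1}. \<bar>Re (Q x)\<bar> \<le> t \<and> pi * M * T \<le> \<bar>Re (Q' x)\<bar>} = {}"
      using pos by auto
    show ?thesis
      unfolding empty using assms by simp
  next
    case 2
    have "measure lborel {x\<in>{0..1}. \<bar>Re (Q x)\<bar> \<le> t \<and> pi * M * T \<le> \<bar>Re (Q' x)\<bar>}
      \<le> (card {x\<in>{0<..<1}. Re (Q' x) = 0} + 1) * (2 * t / (pi * M * T))"
      using sublevel_measure_finite_critical[OF deriv cont 2(1) pos \<open>t \<ge> 0\<close>] .
    \<comment> \<open>Since \<open>M \<ge> 1\<close>, \<open>2 * M + 1 \<le> 3 * M\<close>. The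
      factor 3 is then absorbed by the \<open>pi\<close> in the threshold for the
      derivative.\<close>
    also have "\<dots> \<le> (3 * M) * (2 * t / (pi * M * T))"
      using 2(2) pos assms by (intro mult_right_mono divide_nonneg_pos) auto
    also have "\<dots> = (3 / pi) * (2 * t / T)"
      using assms by (simp add: field_simps)
    also have "\<dots> \<le> 1 * (2 * t / T)"
      using assms pi_gt3 by (intro mult_right_mono) auto
    finally show ?thesis by simp
  qed
qed

text \<open>The derivative of \<open>Q\<close> is \<open>2 * pi * \<i> * M * Q1\<close>. Where
  \<open>Q1\<close> has modulus at least \<open>T\<close>, the real or the imaginary part of the
  derivative is at least \<open>pi * M * T\<close> in absolute value, and the real-variable bound
  applies to that part; each of the two parts costs \<open>2 * t / T\<close>.\<close>

lemma sublevel_measure_expsum_step: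
  fixes c :: "'i \<Rightarrow> complex" and e :: "'i \<Rightarrow> nat"
  assumes "finite I" and deg: "\<And>i. i \<in> I \<Longrightarrow> e i \<le> M" and "M \<ge> 1" "T > 0" "t \<ge> 0"
  defines "Q \<equiv> expsum I c e" and "Q1 \<equiv> expsum I (\<lambda>i. e i / M * c i) e"
  shows "measure lborel {x\<in>{0..1}. cmod (Q x) \<le> t}
    \<le> 4 * t / T + measure lborel {x\<in>{0..1}. cmod (Q1 x) < T}"
proof -
  define Q' where "Q' = expsum I (\<lambda>i. 2 * pi * \<i> * e i * c i) e"
  define A where "A = {x\<in>{0..1}. \<bar>Re (Q x)\<bar> \<le> t \<and> pi * M * T \<le> \<bar>Re (Q' x)\<bar>}"
  define B where "B = {x\<in>{0..1}. \<bar>Im (Q x)\<bar> \<le> t \<and> pi * M * T \<le> \<bar>Im (Q' x)\<bar>}"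
  define E where "E = {x\<in>{0..1}. cmod (Q1 x) < T}"
  define F where "F = {x\<in>{0..1}. cmod (Q x) \<le> t}"
  have [measurable]: "Q \<in> borel_measurable borel" "Q' \<in> borel_measurable borel"
    "Q1 \<in> borel_measurable borel"
    by (simp_all add: Q_def Q'_def Q1_def)
  have fm: "A \<in> fmeasurable lborel" "B \<in> fmeasurable lborel" "E \<in> fmeasurable lborel"
    "F \<in> fmeasurable lborel"
    unfolding A_def B_def E_def F_def
    by (rule fmeasurableI2[of "{0..1}"]; auto intro!: fmeasurable_compact)+
  have A: "measure lborel A \<le> 2 * t / T"
    unfolding A_def Q_def Q'_def using assms by (intro Re_sublevel_measure_expsum) auto
  \<comment> \<open>Multiplying all coefficients by \<open>- \<i>\<close> turns imaginary parts into
    real parts, so one real-variable estimate serves both.\<close>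
  have Im_eq: "Im (expsum I d e x) = Re (expsum I (\<lambda>i. - \<i> * d i) e x)" for d x
    by (simp add: expsum_def Im_sum Re_sum)
  have swap: "(\<lambda>i. - \<i> * (2 * pi * \<i> * e i * c i)) = (\<lambda>i. 2 * pi * \<i> * e i * (- \<i> * c i))"
    by (simp add: fun_eq_iff algebra_simps)
  have B: "measure lborel B \<le> 2 * t / T"
    unfolding B_def Q_def Q'_def Im_eq swap using assms
    by (intro Re_sublevel_measure_expsum) auto
  have Q': "Q' x = 2 * pi * \<i> * M * Q1 x" for x
    unfolding Q'_def Q1_def expsum_def sum_distrib_left using \<open>M \<ge> 1\<close>
    by (intro sum.cong) auto
  have "F \<subseteq> (A \<union> B) \<union> E"
  proof
    fix x assume x: "x \<in> F"
    show "x \<in> (A \<union> B) \<union> E"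
    proof (cases "cmod (Q1 x) < T")
      case True
      then show ?thesis using x by (auto simp: E_def F_def)
    next
      case False
      then have "2 * pi * M * T \<le> 2 * pi * M * cmod (Q1 x)"
        by (intro mult_left_mono) auto
      also have "\<dots> = cmod (Q' x)"
        unfolding Q' by (simp add: norm_mult)
      also have "\<dots> \<le> \<bar>Re (Q' x)\<bar> + \<bar>Im (Q' x)\<bar>"
        by (rule cmod_le)
      finally have "pi * M * T \<le> \<bar>Re (Q' x)\<bar> \<or> pi * M * T \<le> \<bar>Im (Q' x)\<bar>"
        by linarith
      moreover have "\<bar>Re (Q x)\<bar> \<le> t" "\<bar>Im (Q x)\<bar> \<le> t"
        using x abs_Re_le_cmod[of "Q x"] abs_Im_le_cmod[of "Q x"] by (auto simp: F_def)
      ultimately show ?thesis using x by (auto simp: A_def B_def F_def)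
    qed
  qed
  then have "measure lborel F \<le> measure lborel ((A \<union> B) \<union> E)"
    using fm by (intro measure_mono_fmeasurable) auto
  also have "\<dots> \<le> measure lborel (A \<union> B) + measure lborel E"
    using fm by (intro measure_Un_le sets.Un fmeasurableD) auto
  also have "measure lborel (A \<union> B) \<le> measure lborel A + measure lborel B"
    using fm by (intro measure_Un_le) auto
  finally show ?thesis using A B by (simp add: E_def F_def)
qed

text \<open>This is the step from \<open>k\<close> to \<open>k - 1\<close> terms. A unimodular
  factor moves the least exponent to 0, so that differentiation kills the term \<open>i1\<close>;
  division by the top exponent \<open>M\<close> keeps the modulus of the leading coefficient, which
  makes the step iterable.\<close>

lemma sublevel_measure_expsum_reduce:
  fixes c :: "'i \<Rightarrow> complex" and e :: "'i \<Rightarrow> int"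
  assumes fin: "finite I" and card: "card I \<ge> 2" and inj: "inj_on e I"
    and i0: "i0 \<in> I" "\<And>i. i \<in> I \<Longrightarrow> e i \<le> e i0"
  obtains i1 c' e' where "i1 \<in> I" "i1 \<noteq> i0" "cmod (c' i0) = cmod (c i0)" "inj_on e' (I - {i1})"
    "\<forall>i\<in>I. e' i \<le> e' i0"
    "\<forall>T>0. \<forall>t>0. measure lborel {x\<in>{0..1}. cmod (expsum I c e x) \<le> t}
      \<le> 4 * t / T + measure lborel {x\<in>{0..1}. cmod (expsum (I - {i1}) c' e' x) < T}"
proof -
  have "I \<noteq> {}" using i0 by blast
  then obtain i1 where i1: "i1 \<in> I" "\<And>i. i \<in> I \<Longrightarrow> e i1 \<le> e i"
    using arg_min_if_finite[OF fin, of e] by (meson not_less)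
  have "card (I - {i0}) \<noteq> 0" using card i0 by simp
  then have "I - {i0} \<noteq> {}" by force
  then obtain i where "i \<in> I" "i \<noteq> i0" by blast
  then have "i1 \<noteq> i0" using i1 i0 inj by (metis inj_on_contraD order_antisym)
  define f where "f i = nat (e i - e i1)" for i
  define M where "M = f i0"
  have f: "int (f i) = e i - e i1" if "i \<in> I" for i
    using i1(2)[OF that] by (simp add: f_def)
  have "e i0 \<noteq> e i1" using inj i0(1) i1(1) \<open>i1 \<noteq> i0\<close> by (auto dest: inj_onD)
  then have M: "M \<ge> 1" using i1(2)[OF i0(1)] by (simp add: M_def f_def)
  have fM: "f i \<le> M" if "i \<in> I" for i
    using i0(2)[OF that] by (simp add: M_def f_def)
  have norm_eq: "cmod (expsum I c e x) = cmod (expsum I c f x)" for x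
  proof -
    have "expsum I c e x = cis (2 * pi * of_int (e i1) * x) * expsum I c f x"
      unfolding expsum_def sum_distrib_left
    proof (intro sum.cong refl)
      fix i assume "i \<in> I"
      then have "2 * pi * of_int (e i) * x
        = 2 * pi * of_int (e i1) * x + 2 * pi * of_int (int (f i)) * x"
        by (simp only: f) (simp add: algebra_simps)
      then show "c i * cis (2 * pi * of_int (e i) * x)
        = cis (2 * pi * of_int (e i1) * x) * (c i * cis (2 * pi * of_int (int (f i)) * x))"
        by (simp only: flip: cis_mult) (simp add: mult_ac)
    qed
    then show ?thesis by (simp add: norm_mult)
  qed
  \<comment> \<open>The coefficient at \<open>i1\<close> is now 0 because
    \<open>f i1 = 0\<close>.\<close>
  have drop: "expsum I (\<lambda>i. f i / M * c i) f x = expsum (I - {i1}) (\<lambda>i. f i / M * c i) f x" for x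
    unfolding expsum_def using fin i1(1) by (subst sum.remove[of _ i1]) (auto simp: f_def)
  show thesis
  proof (rule that[of i1 "\<lambda>i. f i / M * c i" f])
    show "cmod (complex_of_real (f i0 / M) * c i0) = cmod (c i0)"
      using M by (simp add: M_def)
    show "inj_on (\<lambda>i. int (f i)) (I - {i1})"
      using inj f by (auto simp: inj_on_def)
    show "\<forall>i\<in>I. int (f i) \<le> int (f i0)" using fM by (simp add: M_def)
    show "\<forall>T>0. \<forall>t>0. measure lborel {x\<in>{0..1}. cmod (expsum I c e x) \<le> t}
      \<le> 4 * t / T + measure lborel {x\<in>{0..1}. cmod (expsum (I - {i1}) (\<lambda>i. f i / M * c i) f x) < T}"
      unfolding norm_eq drop[symmetric] using fin fM M
      by (intro allI impI sublevel_measure_expsum_step) auto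
  qed fact+
qed

text \<open>Induction on the number \<open>j + 2\<close> of terms, with one derivative per step. The
  constant depends neither on the exponents nor on the coefficients, apart from the normalisation of
  the leading one.\<close>

lemma sublevel_measure_expsum:
  fixes c :: "'i \<Rightarrow> complex" and e :: "'i \<Rightarrow> int"
  assumes "finite I" "card I = Suc (Suc j)" "inj_on e I"
    and "i0 \<in> I" "\<And>i. i \<in> I \<Longrightarrow> e i \<le> e i0" "1 \<le> cmod (c i0)" "t > 0"
  shows "measure lborel {x\<in>{0..1}. cmod (expsum I c e x) \<le> t} \<le> 4 * (real j + 1) * t powr (1 / (real j + 1))"
  using assms
proof (induction j arbitrary: I c e t)
  case 0
  have card: "card I \<ge> 2" using 0 by simp
  obtain i1 c' e' where i1: "i1 \<in> I" "i1 \<noteq> i0"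
    and c': "cmod (c' i0) = cmod (c i0)" "inj_on e' (I - {i1})" "\<forall>i\<in>I. e' i \<le> e' i0"
    and bound: "\<forall>T>0. \<forall>t>0. measure lborel {x\<in>{0..1}. cmod (expsum I c e x) \<le> t}
      \<le> 4 * t / T + measure lborel {x\<in>{0..1}. cmod (expsum (I - {i1}) c' e' x) < T}"
    by (rule sublevel_measure_expsum_reduce[OF "0.prems"(1) card "0.prems"(3-5), of c])
  have "card (I - {i1}) = 1" using 0 i1 by simp
  moreover have "i0 \<in> I - {i1}" using i1(2) "0.prems"(4) by simp
  ultimately have "I - {i1} = {i0}" by (metis card_1_singletonE singletonD)
  \<comment> \<open>Only the leading term survives. Its modulus is at least 1, so the choice
    \<open>T = 1\<close> leaves no exceptional set.\<close>
  then have empty: "{x\<in>{0..1}. cmod (expsum (I - {i1}) c' e' x) < 1} = {}"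
    using c'(1) "0.prems"(6) by (auto simp: expsum_def norm_mult)
  show ?case
    using bound[rule_format, of 1 t] "0.prems"(7) unfolding empty by simp
next
  case (Suc j)
  have card: "card I \<ge> 2" using Suc.prems by simp
  obtain i1 c' e' where i1: "i1 \<in> I" "i1 \<noteq> i0"
    and c': "cmod (c' i0) = cmod (c i0)" "inj_on e' (I - {i1})" "\<forall>i\<in>I. e' i \<le> e' i0"
    and bound: "\<forall>T>0. \<forall>t>0. measure lborel {x\<in>{0..1}. cmod (expsum I c e x) \<le> t}
      \<le> 4 * t / T + measure lborel {x\<in>{0..1}. cmod (expsum (I - {i1}) c' e' x) < T}"
    by (rule sublevel_measure_expsum_reduce[OF Suc.prems(1) card Suc.prems(3-5), of c])
  let ?Q = "expsum (I - {i1}) c' e'"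
  \<comment> \<open>This choice balances the two contributions: \<open>t / T\<close> and
    \<open>T powr (1 / (real j + 1))\<close> both equal
    \<open>t powr (1 / (real j + 2))\<close>.\<close>
  define T where "T = t powr ((real j + 1) / (real j + 2))"
  have T: "T > 0" using Suc.prems(7) by (simp add: T_def)
  have "{x\<in>{0..1}. cmod (?Q x) < T} \<in> fmeasurable lborel" "{x\<in>{0..1}. cmod (?Q x) \<le> T} \<in> fmeasurable lborel"
    by (rule fmeasurableI2[of "{0..1}"]; auto intro!: fmeasurable_compact)+
  then have "measure lborel {x\<in>{0..1}. cmod (?Q x) < T} \<le> measure lborel {x\<in>{0..1}. cmod (?Q x) \<le> T}"
    by (intro measure_mono_fmeasurable) (auto dest: fmeasurableD)
  also have "\<dots> \<le> 4 * (real j + 1) * T powr (1 / (real j + 1))"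
  proof (rule Suc.IH)
    show "card (I - {i1}) = Suc (Suc j)" using Suc.prems(1,2) i1 by simp
  qed (use Suc.prems i1 c' T in auto)
  also have "T powr (1 / (real j + 1)) = t powr (1 / (real j + 2))"
    unfolding T_def powr_powr by simp
  finally have 1: "measure lborel {x\<in>{0..1}. cmod (?Q x) < T} \<le> 4 * (real j + 1) * t powr (1 / (real j + 2))" .
  have "t / T = t powr (1 - (real j + 1) / (real j + 2))"
    using Suc.prems(7) unfolding T_def powr_diff by simp
  also have "1 - (real j + 1) / (real j + 2) = 1 / (real j + 2)" by (simp add: field_simps)
  finally have 2: "4 * t / T = 4 * t powr (1 / (real j + 2))" by simp
  show ?case
    using bound[rule_format, OF T \<open>t > 0\<close>] 1 unfolding 2 by (simp add: algebra_simps)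
qed

subsection \<open>Trigonometric polynomials on the torus and on lines\<close>

text \<open>Fubini: \<open>lborel\<close> on vectors is the image of the product measure indexed by
  \<open>Basis\<close>, and the indicator of the cube is distributed over the one-variable factors
  \<open>F i\<close>.\<close>

lemma integral_cbox_prod:
  fixes f :: "'n::finite \<Rightarrow> real \<Rightarrow> complex"
  assumes cont: "\<And>i. continuous_on UNIV (f i)"
  shows "(LINT x:(cbox 0 1 :: (real ^ 'n) set)|lborel. \<Prod>i\<in>UNIV. f i (x $ i))
    = (\<Prod>i\<in>UNIV. LINT t:{0..1}|lborel. f i t)"
proof -
  interpret product_sigma_finite "\<lambda>_ :: real ^ 'n. lborel :: real measure" ..
  define F where "F i t = indicator {0..1} t *\<^sub>R f i t" for i and t :: real
  have int: "integrable lborel (F i)" for i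
    unfolding F_def using borel_integrable_compact[of "{0..1}" "f i"] cont
    by (auto simp: indicator_scaleR_eq_if intro: continuous_on_subset)
  have [measurable]: "F i \<in> borel_measurable borel" for i
    using borel_measurable_integrable[OF int[of i]] by simp
  have Basis: "(Basis :: (real ^ 'n) set) = range (\<lambda>i. axis i 1)"
    by (auto simp: Basis_vec_def)
  have inj: "inj (\<lambda>i::'n. axis i (1::real))"
    by (auto simp: inj_def axis_eq_axis)
  have reindex: "(\<Prod>b\<in>Basis. G b) = (\<Prod>i\<in>UNIV. G (axis i 1))" for G :: "real ^ 'n \<Rightarrow> complex"
    unfolding Basis by (subst prod.reindex[OF inj]) simp
  have eq: "indicator (cbox 0 1) x *\<^sub>R (\<Prod>i\<in>UNIV. f i (x $ i))
      = (\<Prod>b\<in>Basis. F (axis_index b) (x \<bullet> b))" for x :: "real ^ 'n"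
  proof -
    have "indicator (cbox 0 1) x *\<^sub>R (\<Prod>i\<in>UNIV. f i (x $ i)) = (\<Prod>i\<in>UNIV. F i (x $ i))"
    proof (cases "x \<in> cbox 0 1")
      case True
      then show ?thesis by (simp add: F_def mem_box_cart)
    next
      case False
      then obtain i where "x $ i \<notin> {0..1}" by (auto simp: mem_box_cart)
      then have "F i (x $ i) = 0" by (simp add: F_def)
      then have "(\<Prod>i\<in>UNIV. F i (x $ i)) = 0" by (auto simp: prod_zero_iff)
      with False show ?thesis by simp
    qed
    also have "\<dots> = (\<Prod>b\<in>Basis. F (axis_index b) (x \<bullet> b))"
      by (simp add: reindex cart_eq_inner_axis[symmetric])
    finally show ?thesis .
  qed
  have "(LINT x:(cbox 0 1 :: (real ^ 'n) set)|lborel. \<Prod>i\<in>UNIV. f i (x $ i))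
    = (\<integral>x. (\<Prod>b\<in>Basis. F (axis_index b) (x \<bullet> b)) \<partial>(lborel :: (real ^ 'n) measure))"
    unfolding set_lebesgue_integral_def eq ..
  also have "\<dots> = (\<integral>x. (\<Prod>b\<in>Basis. F (axis_index b) (x b)) \<partial>(\<Pi>\<^sub>M b\<in>(Basis :: (real ^ 'n) set). lborel))"
    by (subst lborel_eq, subst integral_distr) (simp_all cong: prod.cong)
  also have "\<dots> = (\<Prod>b\<in>(Basis :: (real ^ 'n) set). integral\<^sup>L lborel (F (axis_index b)))"
    by (intro product_integral_prod int) simp
  also have "\<dots> = (\<Prod>i\<in>UNIV. LINT t:{0..1}|lborel. f i t)"
    by (simp add: reindex F_def[abs_def] set_lebesgue_integral_def)
  finally show ?thesis .
qed

lemma integral_cis_2pi: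
  "(LINT t:{0..1}|lborel. cis (2 * pi * of_int m * t)) = (if m = 0 then 1 else 0)"
proof (cases "m = 0")
  case True
  then show ?thesis by (simp add: set_lebesgue_integral_def)
next
  case False
  define F where "F t = cis (2 * pi * of_int m * t) / (2 * pi * of_int m * \<i>)" for t :: real
  have "integral\<^sup>L lborel (\<lambda>t. indicator {0..1} t *\<^sub>R cis (2 * pi * of_int m * t)) = F 1 - F 0"
  proof (rule integral_FTC_atLeastAtMost)
    fix x :: real
    show "(F has_vector_derivative cis (2 * pi * of_int m * x)) (at x within {0..1})"
      unfolding F_def has_vector_derivative_def using False
      by (auto intro!: derivative_eq_intros simp: scaleR_conv_of_real fun_eq_iff mult_ac)
  qed (auto intro!: continuous_intros)
  also have "\<dots> = 0"
    using cis_multiple_2pi[of "of_int m"] by (simp add: F_def mult_ac)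
  finally show ?thesis using False by (simp add: set_lebesgue_integral_def)
qed

section \<open>Characters of the torus and their restriction to lines\<close>

definition torus_char :: "int ^ 'n::finite \<Rightarrow> real ^ 'n \<Rightarrow> complex" where
  "torus_char \<omega> x = cis (2 * pi * (\<Sum>i\<in>UNIV. of_int (\<omega> $ i) * x $ i))"

definition line_pt :: "int ^ 'n::finite \<Rightarrow> real \<Rightarrow> real ^ 'n" where
  "line_pt a t = (\<chi> i. of_int (a $ i) * t)"

lemma torus_char_prod: "torus_char \<omega> x = (\<Prod>i\<in>UNIV. cis (2 * pi * of_int (\<omega> $ i) * x $ i))"
proof -
  have "cis (\<Sum>i\<in>A. u i) = (\<Prod>i\<in>A. cis (u i))" if "finite A" for A and u :: "'a \<Rightarrow> real"
    using that by induction (simp_all flip: cis_mult)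
  from this[of UNIV "\<lambda>i. 2 * pi * of_int (\<omega> $ i) * x $ i"] show ?thesis
    by (simp add: torus_char_def sum_distrib_left mult_ac)
qed

lemma torus_char_add: "torus_char (\<omega> + \<omega>') x = torus_char \<omega> x * torus_char \<omega>' x"
  by (simp add: torus_char_def cis_mult sum.distrib algebra_simps)

lemma cnj_torus_char: "cnj (torus_char \<omega> x) = torus_char (- \<omega>) x"
  by (simp add: torus_char_def cis_cnj sum_negf)

lemma torus_char_zero: "torus_char 0 x = 1"
  by (simp add: torus_char_def)

lemma norm_torus_char: "cmod (torus_char \<omega> x) = 1"
  by (simp add: torus_char_def)

lemma torus_char_line_pt: "torus_char \<omega> (line_pt a t) = cis (2 * pi * of_int (int_dot \<omega> a) * t)"
  by (simp add: torus_char_def line_pt_def int_dot_def sum_distrib_right sum_distrib_left mult_ac)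

lemma continuous_on_torus_char [continuous_intros]: "continuous_on S (torus_char \<omega>)"
  unfolding torus_char_def by (intro continuous_intros)

lemma continuous_on_line_pt [continuous_intros]: "continuous_on S (line_pt a)"
  unfolding line_pt_def by (intro continuous_intros)

lemma integral_torus_char:
  fixes \<omega> :: "int ^ 'n::finite"
  shows "(LINT x:cbox 0 1|lborel. torus_char \<omega> x) = (if \<omega> = 0 then 1 else 0)"
proof -
  have "(LINT x:cbox 0 1|lborel. torus_char \<omega> x)
    = (\<Prod>i\<in>UNIV. LINT t:{0..1}|lborel. cis (2 * pi * of_int (\<omega> $ i) * t))"
    unfolding torus_char_prod by (rule integral_cbox_prod) (intro continuous_intros)
  also have "\<dots> = (if \<omega> = 0 then 1 else 0)"
    unfolding integral_cis_2pi by (auto simp: vec_eq_iff)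
  finally show ?thesis .
qed

section \<open>Trigonometric polynomials with bounded frequencies\<close>

lemma int_supnorm_le_iff: "int_supnorm \<omega> \<le> D \<longleftrightarrow> (\<forall>i. \<bar>\<omega> $ i\<bar> \<le> D)"
  unfolding int_supnorm_def by (subst Max_le_iff) auto

lemma abs_le_int_supnorm: "\<bar>\<omega> $ i\<bar> \<le> int_supnorm \<omega>"
  using int_supnorm_le_iff by blast

lemma int_supnorm_add: "int_supnorm (\<omega> + \<omega>') \<le> int_supnorm \<omega> + int_supnorm \<omega>'"
  unfolding int_supnorm_le_iff
proof
  fix i
  have "\<bar>(\<omega> + \<omega>') $ i\<bar> \<le> \<bar>\<omega> $ i\<bar> + \<bar>\<omega>' $ i\<bar>" by simp
  also have "\<dots> \<le> int_supnorm \<omega> + int_supnorm \<omega>'" by (intro add_mono abs_le_int_supnorm)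
  finally show "\<bar>(\<omega> + \<omega>') $ i\<bar> \<le> int_supnorm \<omega> + int_supnorm \<omega>'" .
qed

lemma int_supnorm_uminus: "int_supnorm (- \<omega>) = int_supnorm \<omega>"
  by (simp add: int_supnorm_def)

lemma int_supnorm_nonneg: "0 \<le> int_supnorm \<omega>"
  using abs_le_int_supnorm abs_ge_zero order.trans by blast

text \<open>The predicate speaks of functions and not of coefficient families: linear statements
  then reduce to single characters by rule induction, and closure under products and powers records
  how \<open>D\<close> grows.\<close>

inductive trig_poly :: "int \<Rightarrow> (real ^ 'n::finite \<Rightarrow> complex) \<Rightarrow> bool" for D where
  trig_poly_char: "int_supnorm \<omega> \<le> D \<Longrightarrow> trig_poly D (\<lambda>x. c * torus_char \<omega> x)"
| trig_poly_add: "trig_poly D f \<Longrightarrow> trig_poly D g \<Longrightarrow> trig_poly D (\<lambda>x. f x + g x)"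

lemma trig_poly_const: "0 \<le> D \<Longrightarrow> trig_poly D (\<lambda>x. c)"
  using trig_poly_char[of 0 D c] by (simp add: torus_char_zero int_supnorm_def)

lemma trig_poly_sum:
  assumes "0 \<le> D" "\<And>j. j \<in> J \<Longrightarrow> trig_poly D (f j)"
  shows "trig_poly D (\<lambda>x. \<Sum>j\<in>J. f j x)"
  using assms(2)
  by (induction J rule: infinite_finite_induct)
    (auto intro: trig_poly_const \<open>0 \<le> D\<close> trig_poly_add)

lemma trig_poly_mult:
  assumes "trig_poly D f" "trig_poly E g"
  shows "trig_poly (D + E) (\<lambda>x. f x * g x)"
  using assms(1)
proof induction
  case (trig_poly_char \<omega> c)
  from assms(2) show ?case
  proof induction
    case (trig_poly_char \<omega>' c')
    have "trig_poly (D + E) (\<lambda>x. (c * c') * torus_char (\<omega> + \<omega>') x)"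
      using \<open>int_supnorm \<omega> \<le> D\<close> trig_poly_char int_supnorm_add[of \<omega> \<omega>']
      by (intro trig_poly.trig_poly_char) linarith
    then show ?case by (simp add: torus_char_add mult_ac)
  next
    case (trig_poly_add f g)
    then show ?case by (auto simp: distrib_left intro: trig_poly.trig_poly_add)
  qed
next
  case (trig_poly_add f g)
  then show ?case by (auto simp: distrib_right intro: trig_poly.trig_poly_add)
qed

lemma trig_poly_power:
  assumes "trig_poly D f"
  shows "trig_poly (int j * D) (\<lambda>x. f x ^ j)"
proof (induction j)
  case 0
  then show ?case by (simp add: trig_poly_const)
next
  case (Suc j)
  from trig_poly_mult[OF assms this] show ?case by (simp add: algebra_simps)
qed

lemma trig_poly_cnj:
  assumes "trig_poly D f"
  shows "trig_poly D (\<lambda>x. cnj (f x))"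
  using assms
proof induction
  case (trig_poly_char \<omega> c)
  then have "trig_poly D (\<lambda>x. cnj c * torus_char (- \<omega>) x)"
    by (intro trig_poly.trig_poly_char) (simp add: int_supnorm_uminus)
  then show ?case by (simp add: cnj_torus_char)
next
  case (trig_poly_add f g)
  then show ?case by (auto intro: trig_poly.trig_poly_add)
qed

lemma continuous_on_trig_poly: "trig_poly D f \<Longrightarrow> continuous_on S f"
  by (induction rule: trig_poly.induct) (auto intro!: continuous_intros)

lemma rho_le:
  assumes "\<omega> \<noteq> 0" "int_dot \<omega> a = 0"
  shows "rho a \<le> ereal (of_int (int_supnorm \<omega>))"
  unfolding rho_def using assms by (intro INF_lower) auto

text \<open>A character integrates to 1 or 0, according to whether its frequency vanishes:
  \<open>\<omega>\<close> on the torus, \<open>int_dot \<omega> a\<close> on the line. For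
  frequencies of norm at most \<open>D\<close> the two conditions agree, since any other case would
  be a relation of \<open>a\<close> shorter than \<open>rho a\<close>.\<close>

lemma trig_poly_integral_line_eq:
  fixes f :: "real ^ 'n::finite \<Rightarrow> complex"
  assumes "trig_poly D f" "ereal (of_int D) < rho a"
  shows "(LINT t:{0..1}|lborel. f (line_pt a t)) = (LINT x:cbox 0 1|lborel. f x)"
  using assms(1)
proof induction
  case (trig_poly_char \<omega> c)
  have "int_dot \<omega> a = 0 \<longleftrightarrow> \<omega> = 0"
  proof
    assume "int_dot \<omega> a = 0"
    show "\<omega> = 0"
    proof (rule ccontr)
      assume "\<omega> \<noteq> 0"
      then have "rho a \<le> ereal (of_int (int_supnorm \<omega>))"
        using \<open>int_dot \<omega> a = 0\<close> by (rule rho_le)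
      also have "\<dots> \<le> ereal (of_int D)" using trig_poly_char by simp
      finally show False using assms(2) by simp
    qed
  qed (simp add: int_dot_def)
  then show ?case
    by (simp add: torus_char_line_pt integral_cis_2pi integral_torus_char)
next
  case (trig_poly_add f g)
  have *: "set_integrable lborel (cbox 0 1) h" "set_integrable lborel {0..1} (\<lambda>t. h (line_pt a t))"
    if "trig_poly D h" for h
  proof -
    show "set_integrable lborel (cbox 0 1) h"
      using continuous_on_trig_poly[OF that] by (intro borel_integrable_compact[folded set_integrable_def]) auto
    have "continuous_on {0..1} (\<lambda>t. h (line_pt a t))"
      by (rule continuous_on_compose2[OF continuous_on_trig_poly[OF that, of UNIV]])
        (auto intro: continuous_intros)
    then show "set_integrable lborel {0..1} (\<lambda>t. h (line_pt a t))"
      unfolding set_integrable_def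
      using borel_integrable_compact[of "{0..1}" "\<lambda>t. h (line_pt a t)"]
      by (simp add: indicator_scaleR_eq_if)
  qed
  show ?case
    using trig_poly_add *[OF trig_poly_add.hyps(1)] *[OF trig_poly_add.hyps(2)]
    by (simp add: set_integral_add)
qed

text \<open>Powers of \<open>q = B + 1\<close> with distinct exponents serve as the entries of
  \<open>a\<close>. In a non-zero relation, \<open>q\<close> divides the coefficient belonging to
  the lowest power that occurs, so this coefficient exceeds \<open>B\<close> in absolute
  value.\<close>

lemma exists_rho_gt:
  obtains a :: "int ^ 'n::finite" where "ereal (of_nat B) < rho a"
proof -
  obtain idx :: "'n \<Rightarrow> nat" where idx: "inj idx"
    using finite_imp_inj_to_nat_seg[of "UNIV :: 'n set"] by auto
  define q where "q = int B + 1"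
  define a :: "int ^ 'n" where "a = (\<chi> i. q ^ idx i)"
  have "int B + 1 \<le> int_supnorm \<omega>" if \<omega>: "\<omega> \<noteq> 0" "int_dot \<omega> a = 0" for \<omega>
  proof -
    have "{i. \<omega> $ i \<noteq> 0} \<noteq> {}" using \<omega>(1) by (auto simp: vec_eq_iff)
    then obtain i where i: "\<omega> $ i \<noteq> 0" "\<And>j. \<omega> $ j \<noteq> 0 \<Longrightarrow> idx i \<le> idx j"
      using arg_min_if_finite[of "{i. \<omega> $ i \<noteq> 0}" idx]
      by (metis (mono_tags, lifting) finite mem_Collect_eq not_less)
    have "int_dot \<omega> a = \<omega> $ i * q ^ idx i + (\<Sum>j\<in>UNIV - {i}. \<omega> $ j * q ^ idx j)"
      unfolding int_dot_def a_def by (subst sum.remove[of _ i]) auto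
    \<comment> \<open>Every other non-zero term carries a strictly higher power of \<open>q\<close>,
      by minimality of \<open>idx i\<close> and injectivity of \<open>idx\<close>.\<close>
    moreover have "q ^ Suc (idx i) dvd (\<Sum>j\<in>UNIV - {i}. \<omega> $ j * q ^ idx j)"
    proof (rule dvd_sum)
      fix j assume j: "j \<in> UNIV - {i}"
      show "q ^ Suc (idx i) dvd \<omega> $ j * q ^ idx j"
      proof (cases "\<omega> $ j = 0")
        case False
        have "idx i \<noteq> idx j" using j idx by (auto dest: injD)
        with i(2)[OF False] have "Suc (idx i) \<le> idx j" by simp
        then show ?thesis by (intro dvd_mult le_imp_power_dvd)
      qed simp
    qed
    ultimately have "q ^ Suc (idx i) dvd \<omega> $ i * q ^ idx i"
      using \<omega>(2) by (metis dvd_0_right dvd_add_left_iff)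
    then have "q dvd \<omega> $ i" by (simp add: q_def)
    then have "q \<le> \<bar>\<omega> $ i\<bar>" using i(1) using dvd_imp_le_int[of "\<omega> $ i" q] by (simp add: q_def)
    then show ?thesis using abs_le_int_supnorm[of \<omega> i] by (simp add: q_def)
  qed
  then have "real B + 1 \<le> of_int (int_supnorm \<omega>)" if "\<omega> \<noteq> 0" "int_dot \<omega> a = 0" for \<omega>
    using that by (metis of_int_1 of_int_add of_int_le_iff of_int_of_nat_eq)
  then have "ereal (of_nat B + 1) \<le> rho a"
    unfolding rho_def by (intro INF_greatest) auto
  moreover have "ereal (of_nat B) < ereal (of_nat B + 1)" by simp
  ultimately show thesis using that less_le_trans by blast
qed

text \<open>The Mahler measure of a univariate polynomial is an integral over
  \<open>real ^ 1\<close>; this identifies it with an integral over the real unit interval.\<close>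

lemma integral_cbox_vec1:
  fixes f :: "real \<Rightarrow> real"
  assumes f [measurable]: "f \<in> borel_measurable borel"
  shows "(LINT x:(cbox 0 1 :: (real ^ 1) set)|lborel. f (x $ 1)) = (LINT t:{0..1}|lborel. f t)"
proof -
  have [measurable]: "(vec :: real \<Rightarrow> real ^ 1) \<in> borel_measurable borel"
    by (intro borel_measurable_continuous_onI) (simp add: vec_def continuous_intros)
  have lborel: "(lborel :: (real ^ 1) measure) = distr lborel borel vec"
  proof (rule lborel_eqI)
    fix l u :: "real ^ 1"
    assume le: "\<And>b. b \<in> Basis \<Longrightarrow> l \<bullet> b \<le> u \<bullet> b"
    have le': "l $ 1 \<le> u $ 1"
      using le[of "axis 1 1"] by (simp add: inner_axis)
    have "vec -` box l u = {l $ 1<..<u $ 1}"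
      by (auto simp: mem_box_cart)
    then show "emeasure (distr lborel borel vec) (box l u) = (\<Prod>b\<in>Basis. (u - l) \<bullet> b)"
      using le' by (simp add: emeasure_distr Basis_vec_def inner_axis prod_ennreal)
  qed simp
  have box: "indicator (cbox 0 1) (vec t :: real ^ 1) = (indicator {0..1} t :: real)" for t
    by (auto simp: indicator_def mem_box_cart)
  show ?thesis
    unfolding set_lebesgue_integral_def lborel using f
    by (subst integral_distr) (auto simp: box)
qed

subsection \<open>The logarithm as a series of moments\<close>

text \<open>The series for \<open>- ln h\<close> with \<open>h = g\<^sup>2 / B\<close> has
  non-negative terms, so it may be integrated termwise as soon as the series of the integrals
  converges. The decay hypothesis gives this convergence, and it also forces the zeros of
  \<open>g\<close> to form a null set.\<close>

lemma integral_ln_eq_moment_series: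
  fixes g :: "'a \<Rightarrow> real"
  assumes fin: "finite_measure M" and space: "measure M (space M) = 1"
    and g [measurable]: "g \<in> borel_measurable M"
    and "B > 0" and g_range: "\<And>x. 0 \<le> g x \<and> (g x)\<^sup>2 \<le> B" and "\<beta> > 0"
    and bound: "\<And>n. n \<ge> 1 \<Longrightarrow> (\<integral>x. (1 - (g x)\<^sup>2 / B) ^ n \<partial>M) \<le> K * real n powr (- \<beta>)"
  defines "I \<equiv> \<lambda>n. \<integral>x. (1 - (g x)\<^sup>2 / B) ^ n \<partial>M"
  shows "summable (\<lambda>n. I (Suc n) / Suc n)"
    and "(\<integral>x. ln (g x) \<partial>M) = ln B / 2 - suminf (\<lambda>n. I (Suc n) / Suc n) / 2"
proof -
  interpret finite_measure M by fact
  define h where "h x = (g x)\<^sup>2 / B" for x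
  have [measurable]: "h \<in> borel_measurable M" unfolding h_def[abs_def] by measurable
  have h: "0 \<le> h x" "h x \<le> 1" for x
    using g_range[of x] \<open>B > 0\<close> by (auto simp: h_def)
  have I: "I n = (\<integral>x. (1 - h x) ^ n \<partial>M)" for n
    by (simp add: I_def h_def)
  have bnd: "norm ((1 - h x) ^ n) \<le> 1" for n x
    using h[of x] by (simp add: power_abs power_le_one)
  have int: "integrable M (\<lambda>x. (1 - h x) ^ n)" for n
    by (rule integrable_const_bound[where B = 1]) (use bnd in auto)
  have I_nonneg: "0 \<le> I n" for n
    unfolding I using h by (intro Bochner_Integration.integral_nonneg) auto
  have I_le: "I n \<le> K * real n powr (- \<beta>)" if "n \<ge> 1" for n
    using bound[OF that] by (simp add: I_def)
  show summable: "summable (\<lambda>n. I (Suc n) / Suc n)"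
  proof (rule summable_comparison_test')
    have "summable (\<lambda>n. real n powr (- \<beta> - 1))"
      using \<open>\<beta> > 0\<close> by (simp add: summable_real_powr_iff)
    then have "summable (\<lambda>n. real (Suc n) powr (- \<beta> - 1))"
      by (subst summable_Suc_iff)
    then show "summable (\<lambda>n. K * real (Suc n) powr (- \<beta> - 1))"
      by (rule summable_mult)
    show "norm (I (Suc n) / Suc n) \<le> K * real (Suc n) powr (- \<beta> - 1)" if "0 \<le> n" for n
    proof -
      have "I (Suc n) / Suc n \<le> K * real (Suc n) powr (- \<beta>) / Suc n"
        by (intro divide_right_mono I_le) auto
      also have "\<dots> = K * real (Suc n) powr (- \<beta> - 1)"
        by (simp add: powr_diff)
      finally show ?thesis using I_nonneg[of "Suc n"] by simp
    qed
  qed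
  \<comment> \<open>At a zero of \<open>g\<close> every power of \<open>1 - h\<close> equals 1, so
    each moment bounds the measure of the zero set. Moments tending to 0 make that set null, and the
    value of \<open>ln 0\<close> becomes irrelevant.\<close>
  have "measure M {x\<in>space M. g x = 0} \<le> I n" for n
  proof -
    have "measure M {x\<in>space M. g x = 0} = (\<integral>x. indicator {x\<in>space M. g x = 0} x \<partial>M)"
      by (simp add: Int_absorb2 subset_eq)
    also have "\<dots> \<le> I n"
      unfolding I using int h
      by (intro integral_mono integrable_real_indicator)
        (auto simp: less_top[symmetric] h_def split: split_indicator)
    finally show ?thesis .
  qed
  moreover have "(\<lambda>n. I (Suc n)) \<longlonglongrightarrow> 0"
  proof (rule tendsto_sandwich[OF _ _ tendsto_const])
    have "(\<lambda>n. real (Suc n) powr (- \<beta>)) \<longlonglongrightarrow> 0"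
      using \<open>\<beta> > 0\<close>
      by (intro tendsto_neg_powr filterlim_compose[OF filterlim_real_sequentially filterlim_Suc]) auto
    from tendsto_mult_right_zero[OF this, of K]
    show "(\<lambda>n. K * real (Suc n) powr (- \<beta>)) \<longlonglongrightarrow> 0" .
    show "\<forall>\<^sub>F n in sequentially. I (Suc n) \<le> K * real (Suc n) powr (- \<beta>)"
      by (intro always_eventually allI I_le) simp
  qed (use I_nonneg in auto)
  ultimately have "measure M {x\<in>space M. g x = 0} \<le> 0"
    by (intro LIMSEQ_le_const[where X = "\<lambda>n. I (Suc n)"]) auto
  then have "emeasure M {x\<in>space M. g x = 0} = 0"
    using measure_nonneg[of M "{x\<in>space M. g x = 0}"]
    by (simp add: emeasure_eq_measure)
  then have g_nz: "AE x in M. g x \<noteq> 0"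
    by (subst AE_iff_measurable[OF _ refl]) auto
  have sums: "(\<lambda>n. (1 - h x) ^ Suc n / Suc n) sums (- ln (h x))" if "g x \<noteq> 0" for x
  proof -
    have "0 < h x" using that \<open>B > 0\<close> by (simp add: h_def)
    then have "(\<lambda>n. - ((1 - h x) ^ n) / of_nat n) sums ln (h x)"
      using ln_series'[of "h x - 1"] h[of x] by simp
    \<comment> \<open>The term of index 0 is a division by 0, hence 0, and may be dropped.\<close>
    then have "(\<lambda>n. - ((1 - h x) ^ Suc n) / of_nat (Suc n)) sums ln (h x)"
      by (subst sums_Suc_iff) simp
    from sums_minus[OF this] show ?thesis by simp
  qed
  define F where "F x = suminf (\<lambda>n. (1 - h x) ^ Suc n / Suc n)" for x
  have int': "integrable M (\<lambda>x. (1 - h x) ^ Suc n / Suc n)" for n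
    using int[of "Suc n"] by simp
  have AE_sum: "AE x in M. summable (\<lambda>n. norm ((1 - h x) ^ Suc n / Suc n))"
    using g_nz
  proof eventually_elim
    case (elim x)
    have "norm ((1 - h x) ^ Suc n / Suc n) = (1 - h x) ^ Suc n / Suc n" for n
      using h[of x] by (simp del: power_Suc)
    with sums[OF elim] show ?case by (simp only: sums_summable)
  qed
  have sum_int: "summable (\<lambda>n. \<integral>x. norm ((1 - h x) ^ Suc n / Suc n) \<partial>M)"
  proof -
    have "(\<integral>x. norm ((1 - h x) ^ Suc n / Suc n) \<partial>M) = I (Suc n) / Suc n" for n
    proof -
      have "norm ((1 - h x) ^ Suc n / Suc n) = (1 - h x) ^ Suc n / Suc n" for x
        using h[of x] by (simp del: power_Suc)
      then show ?thesis by (simp only: I integral_divide_zero)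
    qed
    with summable show ?thesis by simp
  qed
  have F_int: "integrable M F"
    unfolding F_def[abs_def] by (rule integrable_suminf[OF int' AE_sum sum_int])
  have F: "(\<integral>x. F x \<partial>M) = suminf (\<lambda>n. I (Suc n) / Suc n)"
    unfolding F_def integral_suminf[OF int' AE_sum sum_int] I by (simp only: integral_divide_zero)
  have "(\<integral>x. ln (g x) \<partial>M) = (\<integral>x. ln B / 2 - F x / 2 \<partial>M)"
  proof (rule integral_cong_AE)
    show "AE x in M. ln (g x) = ln B / 2 - F x / 2"
      using g_nz
    proof eventually_elim
      case (elim x)
      have "g x > 0" using elim g_range[of x] by simp
      then have "ln (h x) = 2 * ln (g x) - ln B"
        using \<open>B > 0\<close> by (simp add: h_def ln_div ln_realpow)
      then show ?case using sums_unique[OF sums[OF elim]] by (simp add: F_def)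
    qed
  qed (use F_int in measurable)
  also have "\<dots> = ln B / 2 - (\<integral>x. F x \<partial>M) / 2"
    using F_int space by (simp add: Bochner_Integration.integral_diff)
  finally show "(\<integral>x. ln (g x) \<partial>M) = ln B / 2 - suminf (\<lambda>n. I (Suc n) / Suc n) / 2"
    unfolding F .
qed

text \<open>The space is split at \<open>h x \<le> s\<close> with
  \<open>s = real n powr (- 1 / 2)\<close>. The sublevel set contributes at most its measure, in
  which the choice of \<open>s\<close> halves the exponent \<open>\<gamma>\<close>; elsewhere the
  integrand is at most \<open>(1 - s) ^ n\<close>, hence at most \<open>exp (- sqrt n)\<close>,
  which is smaller than the claimed rate because \<open>\<gamma> \<le> 1\<close>.\<close>

lemma moment_decay:
  fixes h :: "'a \<Rightarrow> real"
  assumes fin: "finite_measure M" and space: "measure M (space M) = 1"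
    and h [measurable]: "h \<in> borel_measurable M" and h_range: "\<And>x. 0 \<le> h x \<and> h x \<le> 1"
    and \<gamma>: "0 \<le> \<gamma>" "\<gamma> \<le> 1"
    and sublevel: "\<And>s. s > 0 \<Longrightarrow> measure M {x\<in>space M. h x \<le> s} \<le> K * s powr \<gamma>"
    and n: "n \<ge> 1"
  shows "(\<integral>x. (1 - h x) ^ n \<partial>M) \<le> (K + 1) * real n powr (- (\<gamma> / 2))"
proof -
  interpret finite_measure M by fact
  define s where "s = real n powr (- 1 / 2)"
  have s: "0 < s" "s \<le> 1" using n powr_mono[of "- 1 / 2" 0 "real n"] by (auto simp: s_def)
  have "(\<integral>x. (1 - h x) ^ n \<partial>M) \<le> (\<integral>x. indicator {x\<in>space M. h x \<le> s} x + (1 - s) ^ n \<partial>M)"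
  proof (rule integral_mono)
    show "integrable M (\<lambda>x. (1 - h x) ^ n)"
      by (rule integrable_const_bound[where B = 1])
        (use h_range in \<open>auto simp: power_abs power_le_one\<close>)
    show "integrable M (\<lambda>x. indicator {x\<in>space M. h x \<le> s} x + (1 - s) ^ n)"
      by (intro Bochner_Integration.integrable_add integrable_real_indicator)
        (auto simp: less_top[symmetric])
    show "(1 - h x) ^ n \<le> indicator {x\<in>space M. h x \<le> s} x + (1 - s) ^ n" if "x \<in> space M" for x
    proof (cases "h x \<le> s")
      case True
      have "(1 - h x) ^ n \<le> 1" using h_range[of x] by (intro power_le_one) auto
      moreover have "0 \<le> (1 - s) ^ n" using s by simp
      ultimately show ?thesis using True that by simp
    next
      case False
      then show ?thesis using h_range[of x] by (auto intro!: power_mono)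
    qed
  qed
  also have "\<dots> = measure M {x\<in>space M. h x \<le> s} + (1 - s) ^ n"
    using space by (subst Bochner_Integration.integral_add)
      (auto simp: less_top[symmetric] Int_absorb2 subset_eq intro!: integrable_real_indicator)
  also have "measure M {x\<in>space M. h x \<le> s} \<le> K * real n powr (- (\<gamma> / 2))"
    using sublevel[OF s(1)] by (simp add: s_def powr_powr)
  also have "(1 - s) ^ n \<le> real n powr (- (\<gamma> / 2))"
  proof -
    have "(1 - s) ^ n \<le> exp (- s) ^ n"
      using s exp_ge_add_one_self[of "- s"] by (intro power_mono) auto
    also have "\<dots> = exp (- sqrt n)"
    proof -
      have "s * real n = sqrt n"
        using n by (simp add: s_def powr_minus powr_half_sqrt divide_simps)
      then show ?thesis by (simp add: mult.commute flip: exp_of_nat_mult)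
    qed
    also have "\<dots> = 1 / exp (sqrt n)" by (simp add: exp_minus divide_inverse)
    also have "\<dots> \<le> 1 / sqrt n"
    proof -
      have "sqrt n \<le> exp (sqrt n)" using exp_ge_add_one_self[of "sqrt n"] by linarith
      then show ?thesis using n by (intro divide_left_mono) auto
    qed
    also have "\<dots> = real n powr (- 1 / 2)"
      using n by (simp add: powr_minus powr_half_sqrt divide_simps)
    also have "\<dots> \<le> real n powr (- (\<gamma> / 2))"
      using n \<gamma> by (intro powr_mono) auto
    finally show ?thesis .
  qed
  finally show ?thesis by (simp add: algebra_simps)
qed

subsection \<open>Mahler measures\<close>

definition torus_fun :: "'n::finite laurent \<Rightarrow> real ^ 'n \<Rightarrow> complex" where
  "torus_fun P x = (\<Sum>\<omega>\<in>Poly_Mapping.keys P. Poly_Mapping.lookup P \<omega> * torus_char \<omega> x)"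

text \<open>This is the normalising constant, the sum of the absolute values of the coefficients,
  which bounds \<open>P\<close> on the torus.\<close>

definition coeff_norm :: "'n::finite laurent \<Rightarrow> real" where
  "coeff_norm P = (\<Sum>\<omega>\<in>Poly_Mapping.keys P. cmod (Poly_Mapping.lookup P \<omega>))"

lemma torus_pt_nth: "torus_pt x $ i = cis (2 * pi * x $ i)"
  by (simp add: torus_pt_def cis_conv_exp mult_ac)

lemma laurent_eval_torus_pt: "laurent_eval P (torus_pt x) = torus_fun P x"
  unfolding laurent_eval_def torus_fun_def torus_char_prod torus_pt_nth cis_power_int
  by (simp add: mult_ac)

lemma laurent_eval_monomial_subst_torus_pt:
  "laurent_eval (monomial_subst a P) (torus_pt x) = torus_fun P (line_pt a (x $ 1))"
proof -
  let ?w = "cis (2 * pi * x $ 1)"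
  have "torus_pt x = (\<chi> _. ?w)"
    by (simp add: vec_eq_iff torus_pt_nth)
  moreover have "(\<chi> i. ?w powi (a $ i)) = torus_pt (line_pt a (x $ 1))"
    by (simp add: vec_eq_iff torus_pt_nth line_pt_def cis_power_int mult_ac)
  ultimately show ?thesis
    by (simp add: laurent_eval_monomial_subst flip: laurent_eval_torus_pt)
qed

lemma norm_torus_fun_le: "cmod (torus_fun P x) \<le> coeff_norm P"
  unfolding torus_fun_def coeff_norm_def
  by (rule order.trans[OF norm_sum]) (simp add: norm_mult norm_torus_char)

lemma coeff_norm_pos: "P \<noteq> 0 \<Longrightarrow> 0 < coeff_norm P"
  unfolding coeff_norm_def by (intro sum_pos) (auto simp: in_keys_iff)

lemma continuous_on_torus_fun [continuous_intros]:
  "continuous_on S f \<Longrightarrow> continuous_on S (\<lambda>x. torus_fun P (f x))"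
  unfolding torus_fun_def
  by (intro continuous_intros continuous_on_compose2[OF continuous_on_torus_char[of UNIV]]) auto

lemma borel_measurable_torus_fun [measurable]: "torus_fun P \<in> borel_measurable borel"
  by (intro borel_measurable_continuous_onI continuous_intros)

lemma borel_measurable_torus_fun_line [measurable]:
  "(\<lambda>t. torus_fun P (line_pt a t)) \<in> borel_measurable borel"
  by (intro borel_measurable_continuous_onI continuous_intros)

lemma torus_fun_line_pt:
  "torus_fun P (line_pt a t) = expsum (Poly_Mapping.keys P) (Poly_Mapping.lookup P) (\<lambda>\<omega>. int_dot \<omega> a) t"
  by (simp add: torus_fun_def expsum_def torus_char_line_pt)

lemma mahler_torus: "mahler P = (LINT x:cbox 0 1|lborel. ln (cmod (torus_fun P x)))"
  by (simp add: mahler_def laurent_eval_torus_pt)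

lemma mahler_line:
  "mahler (monomial_subst a P) = (LINT t:{0..1}|lborel. ln (cmod (torus_fun P (line_pt a t))))"
  unfolding mahler_def laurent_eval_monomial_subst_torus_pt
  by (rule integral_cbox_vec1) measurable

section \<open>Moments on the torus and on lines\<close>

definition torus_moment :: "'n::finite laurent \<Rightarrow> nat \<Rightarrow> real" where
  "torus_moment P n = (LINT x:cbox 0 1|lborel. (1 - (cmod (torus_fun P x))\<^sup>2 / (coeff_norm P)\<^sup>2) ^ n)"

definition line_moment :: "'n::finite laurent \<Rightarrow> int ^ 'n \<Rightarrow> nat \<Rightarrow> real" where
  "line_moment P a n =
     (LINT t:{0..1}|lborel. (1 - (cmod (torus_fun P (line_pt a t)))\<^sup>2 / (coeff_norm P)\<^sup>2) ^ n)"

text \<open>Any upper bound for the norms of the exponents would serve; a sum, unlike a maximum, is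
  meaningful and non-negative for empty support as well.\<close>

definition key_bound :: "'n::finite laurent \<Rightarrow> int" where
  "key_bound P = (\<Sum>\<omega>\<in>Poly_Mapping.keys P. int_supnorm \<omega>)"

lemma key_bound_nonneg: "0 \<le> key_bound P"
  unfolding key_bound_def by (intro sum_nonneg int_supnorm_nonneg)

lemma int_supnorm_le_key_bound: "\<omega> \<in> Poly_Mapping.keys P \<Longrightarrow> int_supnorm \<omega> \<le> key_bound P"
  unfolding key_bound_def by (intro member_le_sum int_supnorm_nonneg) auto

text \<open>The squared modulus is \<open>torus_fun P\<close> times its conjugate, which doubles the
  bound on the frequencies; the \<open>n\<close>-th power multiplies it by \<open>n\<close>. Below
  \<open>rho a\<close>, such trigonometric polynomials have equal integrals on the line and on the
  torus.\<close>

lemma line_moment_eq_torus_moment: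
  assumes "ereal (of_int (int n * (2 * key_bound P))) < rho a"
  shows "line_moment P a n = torus_moment P n"
proof -
  define f where "f x = (1 + complex_of_real (- 1 / (coeff_norm P)\<^sup>2) * (torus_fun P x * cnj (torus_fun P x))) ^ n" for x
  have G: "trig_poly (key_bound P) (torus_fun P)"
    unfolding torus_fun_def
    by (intro trig_poly_sum key_bound_nonneg trig_poly_char int_supnorm_le_key_bound)
  have "trig_poly (0 + (key_bound P + key_bound P))
    (\<lambda>x. complex_of_real (- 1 / (coeff_norm P)\<^sup>2) * (torus_fun P x * cnj (torus_fun P x)))"
    by (intro trig_poly_mult trig_poly_cnj trig_poly_const G) simp
  then have "trig_poly (2 * key_bound P)
    (\<lambda>x. 1 + complex_of_real (- 1 / (coeff_norm P)\<^sup>2) * (torus_fun P x * cnj (torus_fun P x)))"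
    using key_bound_nonneg[of P] by (intro trig_poly_add trig_poly_const) auto
  then have "trig_poly (int n * (2 * key_bound P)) f"
    unfolding f_def by (rule trig_poly_power)
  from trig_poly_integral_line_eq[OF this assms]
  have eq: "(LINT t:{0..1}|lborel. f (line_pt a t)) = (LINT x:cbox 0 1|lborel. f x)" .
  have f: "f x = of_real ((1 - (cmod (torus_fun P x))\<^sup>2 / (coeff_norm P)\<^sup>2) ^ n)" for x
    unfolding f_def complex_norm_square[symmetric] by simp
  show ?thesis
    using eq unfolding f line_moment_def torus_moment_def set_integral_complex_of_real
    by (simp only: of_real_eq_iff)
qed

text \<open>The difference of two exponents with the same image would be a relation of
  \<open>a\<close> of norm at most \<open>2 * key_bound P\<close>. Injectivity keeps all
  \<open>k\<close> terms separate on the line, as Lawton's bound requires.\<close>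

lemma inj_on_int_dot:
  assumes "ereal (of_int (2 * key_bound P)) < rho a"
  shows "inj_on (\<lambda>\<omega>. int_dot \<omega> a) (Poly_Mapping.keys P)"
proof (rule inj_onI, rule ccontr)
  fix \<omega> \<omega>' assume *: "\<omega> \<in> Poly_Mapping.keys P" "\<omega>' \<in> Poly_Mapping.keys P"
    "int_dot \<omega> a = int_dot \<omega>' a" "\<omega> \<noteq> \<omega>'"
  have "int_dot (\<omega> + - \<omega>') a = 0"
    using *(3) by (simp add: int_dot_def sum_subtractf algebra_simps)
  then have "rho a \<le> ereal (of_int (int_supnorm (\<omega> + - \<omega>')))"
    using *(4) by (intro rho_le) auto
  also have "int_supnorm (\<omega> + - \<omega>') \<le> 2 * key_bound P"
    using int_supnorm_add[of \<omega> "- \<omega>'"] int_supnorm_le_key_bound[OF *(1)] int_supnorm_le_key_bound[OF *(2)]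
    by (simp add: int_supnorm_uminus)
  finally show False using assms by simp
qed

lemma unit_cube_measure:
  shows "finite_measure (restrict_space lborel (cbox 0 1 :: (real ^ 'n::finite) set))"
    and "measure (restrict_space lborel (cbox 0 1 :: (real ^ 'n) set))
      (space (restrict_space lborel (cbox 0 1 :: (real ^ 'n) set))) = 1"
proof -
  have "emeasure lborel (cbox 0 1 :: (real ^ 'n) set) = 1"
    by (simp add: emeasure_lborel_cbox_eq Basis_vec_def inner_axis prod.neutral)
  then show "finite_measure (restrict_space lborel (cbox 0 1 :: (real ^ 'n::finite) set))"
    and "measure (restrict_space lborel (cbox 0 1 :: (real ^ 'n) set))
      (space (restrict_space lborel (cbox 0 1 :: (real ^ 'n) set))) = 1"
    by (auto intro!: finite_measureI simp: emeasure_restrict_space space_restrict_space measure_def)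
qed

lemma unit_interval_measure:
  shows "finite_measure (restrict_space lborel {0..1::real})"
    and "measure (restrict_space lborel {0..1::real}) (space (restrict_space lborel {0..1::real})) = 1"
  by (auto intro!: finite_measureI simp: emeasure_restrict_space space_restrict_space measure_def)

lemma moment_range:
  assumes "P \<noteq> 0"
  shows "0 \<le> (cmod (torus_fun P x))\<^sup>2 / (coeff_norm P)\<^sup>2 \<and> (cmod (torus_fun P x))\<^sup>2 / (coeff_norm P)\<^sup>2 \<le> 1"
  using norm_torus_fun_le[of P x] coeff_norm_pos[OF assms] by (auto simp: power_mono)

text \<open>Which exponent becomes the leading one depends on \<open>a\<close>. Division by the
  least coefficient modulus \<open>\<mu>\<close> normalises every candidate at once, so
  \<open>K\<close> does not depend on \<open>a\<close>. The exponent is half of Lawton's because the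
  sublevel set is that of a squared modulus.\<close>

lemma sublevel_measure_line:
  fixes P :: "'n::finite laurent"
  assumes "P \<noteq> 0" and card: "card (Poly_Mapping.keys P) = Suc (Suc j)"
  shows "\<exists>K\<ge>0. \<forall>a s. inj_on (\<lambda>\<omega>. int_dot \<omega> a) (Poly_Mapping.keys P) \<longrightarrow> s > 0 \<longrightarrow>
    measure lborel {t\<in>{0..1}. (cmod (torus_fun P (line_pt a t)))\<^sup>2 / (coeff_norm P)\<^sup>2 \<le> s}
      \<le> K * s powr (1 / (2 * (real j + 1)))"
proof -
  let ?c = "Poly_Mapping.lookup P" and ?A = "Poly_Mapping.keys P"
  define \<mu> where "\<mu> = Min ((\<lambda>\<omega>. cmod (?c \<omega>)) ` ?A)"
  have "?A \<noteq> {}" using card by auto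
  then have \<mu>: "\<mu> > 0" "\<And>\<omega>. \<omega> \<in> ?A \<Longrightarrow> \<mu> \<le> cmod (?c \<omega>)"
    unfolding \<mu>_def by (auto simp: in_keys_iff)
  \<comment> \<open>This local \<open>L\<close> is the norm of the coefficients after division by
    \<open>\<mu>\<close>.\<close>
  define L where "L = coeff_norm P / \<mu>"
  have L: "L > 0" using \<mu> coeff_norm_pos[OF assms(1)] by (simp add: L_def)
  show ?thesis
  proof (intro exI[of _ "4 * (real j + 1) * L powr (1 / (real j + 1))"] conjI allI impI)
    fix a :: "int ^ 'n" and s :: real
    let ?e = "\<lambda>\<omega>. int_dot \<omega> a"
    assume inj: "inj_on ?e ?A" and s: "s > 0"
    have "Max (?e ` ?A) \<in> ?e ` ?A" using \<open>?A \<noteq> {}\<close> by (intro Max_in) auto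
    then obtain \<omega>0 where \<omega>0: "\<omega>0 \<in> ?A" "?e \<omega>0 = Max (?e ` ?A)" by auto
    have scale: "expsum ?A (\<lambda>\<omega>. ?c \<omega> / \<mu>) ?e t = torus_fun P (line_pt a t) / \<mu>" for t
      by (simp add: torus_fun_line_pt expsum_def sum_divide_distrib)
    have iff: "(cmod (torus_fun P (line_pt a t)))\<^sup>2 / (coeff_norm P)\<^sup>2 \<le> s
        \<longleftrightarrow> cmod (expsum ?A (\<lambda>\<omega>. ?c \<omega> / \<mu>) ?e t) \<le> L * sqrt s" for t
    proof -
      let ?g = "cmod (torus_fun P (line_pt a t))"
      have "?g\<^sup>2 / (coeff_norm P)\<^sup>2 \<le> s \<longleftrightarrow> (?g / coeff_norm P)\<^sup>2 \<le> s"
        by (simp add: power_divide)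
      also have "\<dots> \<longleftrightarrow> ?g / coeff_norm P \<le> sqrt s"
        using s coeff_norm_pos[OF assms(1)] real_sqrt_le_iff[of "(?g / coeff_norm P)\<^sup>2" s] by simp
      also have "\<dots> \<longleftrightarrow> ?g / \<mu> \<le> L * sqrt s"
        using \<mu>(1) coeff_norm_pos[OF assms(1)] by (simp add: L_def field_simps)
      finally show ?thesis using \<mu>(1) by (simp add: scale norm_divide)
    qed
    have "measure lborel {t\<in>{0..1}. (cmod (torus_fun P (line_pt a t)))\<^sup>2 / (coeff_norm P)\<^sup>2 \<le> s}
      \<le> 4 * (real j + 1) * (L * sqrt s) powr (1 / (real j + 1))"
      unfolding iff
    proof (rule sublevel_measure_expsum[OF _ card inj \<omega>0(1)])
      show "1 \<le> cmod (?c \<omega>0 / \<mu>)" using \<mu>(1) \<mu>(2)[OF \<omega>0(1)] by (simp add: norm_divide)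
    qed (use \<omega>0 L s in auto)
    also have "(L * sqrt s) powr (1 / (real j + 1))
      = L powr (1 / (real j + 1)) * s powr (1 / (2 * (real j + 1)))"
      using L s by (simp add: powr_mult powr_powr flip: powr_half_sqrt)
    finally show "measure lborel {t\<in>{0..1}. (cmod (torus_fun P (line_pt a t)))\<^sup>2 / (coeff_norm P)\<^sup>2 \<le> s}
      \<le> 4 * (real j + 1) * L powr (1 / (real j + 1)) * s powr (1 / (2 * (real j + 1)))"
      by (simp only: mult.assoc)
  qed simp
qed

text \<open>Lawton's exponent \<open>1 / (real j + 1)\<close> has been halved by the square and is
  halved again by \<open>moment_decay\<close>; this is the origin of the factor 4.\<close>

lemma line_moment_decay:
  fixes P :: "'n::finite laurent"
  assumes "P \<noteq> 0" and card: "card (Poly_Mapping.keys P) = Suc (Suc j)"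
  shows "\<exists>K\<ge>0. \<forall>a n. inj_on (\<lambda>\<omega>. int_dot \<omega> a) (Poly_Mapping.keys P) \<longrightarrow> n \<ge> 1 \<longrightarrow>
    line_moment P a n \<le> K * real n powr (- (1 / (4 * (real j + 1))))"
proof -
  obtain K where K: "K \<ge> 0" and sub: "\<forall>a s. inj_on (\<lambda>\<omega>. int_dot \<omega> a) (Poly_Mapping.keys P) \<longrightarrow> s > 0 \<longrightarrow>
    measure lborel {t\<in>{0..1}. (cmod (torus_fun P (line_pt a t)))\<^sup>2 / (coeff_norm P)\<^sup>2 \<le> s}
      \<le> K * s powr (1 / (2 * (real j + 1)))"
    using sublevel_measure_line[OF assms] by blast
  show ?thesis
  proof (intro exI[of _ "K + 1"] conjI allI impI)
    fix a :: "int ^ 'n" and n :: nat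
    assume inj: "inj_on (\<lambda>\<omega>. int_dot \<omega> a) (Poly_Mapping.keys P)" and n: "n \<ge> 1"
    define h where "h t = (cmod (torus_fun P (line_pt a t)))\<^sup>2 / (coeff_norm P)\<^sup>2" for t
    let ?M = "restrict_space lborel {0..1::real}"
    have meas: "h \<in> borel_measurable ?M"
      unfolding h_def by (rule measurable_restrict_space1) measurable
    have "(\<integral>t. (1 - h t) ^ n \<partial>?M) \<le> (K + 1) * real n powr (- (1 / (2 * (real j + 1)) / 2))"
    proof (rule moment_decay[OF unit_interval_measure meas])
      show "0 \<le> h t \<and> h t \<le> 1" for t
        unfolding h_def by (rule moment_range[OF assms(1)])
      show "measure ?M {t\<in>space ?M. h t \<le> s} \<le> K * s powr (1 / (2 * (real j + 1)))" if "s > 0" for s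
        using sub[rule_format, OF inj that]
        by (subst measure_restrict_space) (auto simp: space_restrict_space h_def)
    qed (use n in auto)
    moreover have "line_moment P a n = (\<integral>t. (1 - h t) ^ n \<partial>?M)"
      unfolding line_moment_def h_def set_lebesgue_integral_def by (subst integral_restrict_space) auto
    ultimately show "line_moment P a n \<le> (K + 1) * real n powr (- (1 / (4 * (real j + 1))))"
      by simp
  qed (use K in simp)
qed

text \<open>For each fixed \<open>n\<close> there is a line with \<open>rho a\<close> so large that
  its \<open>n\<close>-th moment equals that of the torus. As the line bound is uniform in
  \<open>a\<close>, it carries over.\<close>

lemma torus_moment_decay:
  fixes P :: "'n::finite laurent"
  assumes K: "\<forall>a n. inj_on (\<lambda>\<omega>. int_dot \<omega> a) (Poly_Mapping.keys P) \<longrightarrow> n \<ge> 1 \<longrightarrow>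
      line_moment P a n \<le> K * real n powr (- \<beta>)"
    and n: "n \<ge> 1"
  shows "torus_moment P n \<le> K * real n powr (- \<beta>)"
proof -
  obtain a :: "int ^ 'n" where a: "ereal (of_nat (n * nat (2 * key_bound P))) < rho a"
    using exists_rho_gt by blast
  have 1: "ereal (of_int (int n * (2 * key_bound P))) < rho a"
    using a key_bound_nonneg[of P] by simp
  \<comment> \<open>Because \<open>n \<ge> 1\<close>, the threshold for equal moments also
    guarantees injectivity.\<close>
  have "2 * key_bound P \<le> int n * (2 * key_bound P)"
    using n key_bound_nonneg[of P] mult_right_mono[of 1 "int n" "2 * key_bound P"] by simp
  then have "ereal (of_int (2 * key_bound P)) \<le> ereal (of_int (int n * (2 * key_bound P)))"
    by (simp only: ereal_less_eq of_int_le_iff)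
  then have "ereal (of_int (2 * key_bound P)) < rho a"
    using 1 by (rule le_less_trans)
  then show ?thesis
    using K n inj_on_int_dot line_moment_eq_torus_moment[OF 1] by metis
qed

section \<open>Mahler measures as moment series\<close>

lemma mahler_torus_series:
  fixes P :: "'n::finite laurent"
  assumes "P \<noteq> 0" "\<beta> > 0" and bound: "\<And>n. n \<ge> 1 \<Longrightarrow> torus_moment P n \<le> K * real n powr (- \<beta>)"
  shows "summable (\<lambda>n. torus_moment P (Suc n) / Suc n)"
    and "mahler P = ln ((coeff_norm P)\<^sup>2) / 2 - suminf (\<lambda>n. torus_moment P (Suc n) / Suc n) / 2"
proof -
  let ?M = "restrict_space lborel (cbox 0 1 :: (real ^ 'n) set)"
  have meas: "(\<lambda>x. cmod (torus_fun P x)) \<in> borel_measurable ?M"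
    by (rule measurable_restrict_space1) measurable
  have mom: "torus_moment P n = (\<integral>x. (1 - (cmod (torus_fun P x))\<^sup>2 / (coeff_norm P)\<^sup>2) ^ n \<partial>?M)" for n
    unfolding torus_moment_def set_lebesgue_integral_def by (subst integral_restrict_space) auto
  have pos: "0 < (coeff_norm P)\<^sup>2" using coeff_norm_pos[OF assms(1)] by simp
  have range: "0 \<le> cmod (torus_fun P x) \<and> (cmod (torus_fun P x))\<^sup>2 \<le> (coeff_norm P)\<^sup>2" for x
    using norm_torus_fun_le[of P x] by (auto simp: power_mono)
  note series = integral_ln_eq_moment_series[OF unit_cube_measure meas pos range \<open>\<beta> > 0\<close> bound[unfolded mom],
      folded mom]
  show "summable (\<lambda>n. torus_moment P (Suc n) / Suc n)"
    by (rule series(1))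
  have "mahler P = (\<integral>x. ln (cmod (torus_fun P x)) \<partial>?M)"
    unfolding mahler_torus set_lebesgue_integral_def by (subst integral_restrict_space) auto
  then show "mahler P = ln ((coeff_norm P)\<^sup>2) / 2 - suminf (\<lambda>n. torus_moment P (Suc n) / Suc n) / 2"
    using series(2) by simp
qed

lemma mahler_line_series:
  fixes P :: "'n::finite laurent"
  assumes "P \<noteq> 0" "\<beta> > 0" and bound: "\<And>n. n \<ge> 1 \<Longrightarrow> line_moment P a n \<le> K * real n powr (- \<beta>)"
  shows "summable (\<lambda>n. line_moment P a (Suc n) / Suc n)"
    and "mahler (monomial_subst a P)
      = ln ((coeff_norm P)\<^sup>2) / 2 - suminf (\<lambda>n. line_moment P a (Suc n) / Suc n) / 2"
proof -
  let ?M = "restrict_space lborel {0..1::real}"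
  have meas: "(\<lambda>t. cmod (torus_fun P (line_pt a t))) \<in> borel_measurable ?M"
    by (rule measurable_restrict_space1) measurable
  have mom: "line_moment P a n
      = (\<integral>t. (1 - (cmod (torus_fun P (line_pt a t)))\<^sup>2 / (coeff_norm P)\<^sup>2) ^ n \<partial>?M)" for n
    unfolding line_moment_def set_lebesgue_integral_def by (subst integral_restrict_space) auto
  have pos: "0 < (coeff_norm P)\<^sup>2" using coeff_norm_pos[OF assms(1)] by simp
  have range: "0 \<le> cmod (torus_fun P x) \<and> (cmod (torus_fun P x))\<^sup>2 \<le> (coeff_norm P)\<^sup>2" for x
    using norm_torus_fun_le[of P x] by (auto simp: power_mono)
  note series = integral_ln_eq_moment_series[OF unit_interval_measure meas pos range \<open>\<beta> > 0\<close> bound[unfolded mom],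
      folded mom]
  show "summable (\<lambda>n. line_moment P a (Suc n) / Suc n)"
    by (rule series(1))
  have "mahler (monomial_subst a P) = (\<integral>t. ln (cmod (torus_fun P (line_pt a t))) \<partial>?M)"
    unfolding mahler_line set_lebesgue_integral_def by (subst integral_restrict_space) auto
  then show "mahler (monomial_subst a P)
      = ln ((coeff_norm P)\<^sup>2) / 2 - suminf (\<lambda>n. line_moment P a (Suc n) / Suc n) / 2"
    using series(2) by simp
qed

lemma torus_moment_nonneg: "P \<noteq> 0 \<Longrightarrow> 0 \<le> torus_moment P n"
  unfolding torus_moment_def set_lebesgue_integral_def
  using moment_range[of P] by (intro Bochner_Integration.integral_nonneg) auto

lemma line_moment_nonneg: "P \<noteq> 0 \<Longrightarrow> 0 \<le> line_moment P a n"
  unfolding line_moment_def set_lebesgue_integral_def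
  using moment_range[of P] by (intro Bochner_Integration.integral_nonneg) auto

text \<open>This serves the case \<open>rho a = \<infinity>\<close>, where the sign of the exponent
  is not known because \<open>\<epsilon>\<close> may be large.\<close>

lemma ereal_powr_PInf_nonneg: "0 \<le> ereal_powr \<infinity> s"
  by (simp add: ereal_powr_def)

theorem theoremA2:
  fixes P :: "'n::finite laurent" and k :: nat and \<epsilon> :: real
  assumes "P \<noteq> 0"
    and "card (Poly_Mapping.keys P) = k"
    and "k \<ge> 2"
    and "\<epsilon> > 0"
  shows "\<exists>C R :: real. \<forall>a :: int ^ 'n. rho a \<ge> ereal R \<longrightarrow>
           ereal \<bar>mahler (monomial_subst a P) - mahler P\<bar>
             \<le> ereal C * ereal_powr (rho a) (- (1 / (4 * (real k - 1))) + \<epsilon>)"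
proof -
  obtain j where j: "k = Suc (Suc j)"
    using \<open>k \<ge> 2\<close> by (metis add_2_eq_Suc le_Suc_ex)
  define \<beta> where "\<beta> = 1 / (4 * (real k - 1))"
  have \<beta>: "\<beta> > 0" using \<open>k \<ge> 2\<close> by (simp add: \<beta>_def)
  have \<beta>': "\<beta> = 1 / (4 * (real j + 1))" by (simp add: \<beta>_def j)
  obtain K where K: "K \<ge> 0" and line: "\<forall>a n. inj_on (\<lambda>\<omega>. int_dot \<omega> a) (Poly_Mapping.keys P) \<longrightarrow> n \<ge> 1 \<longrightarrow>
      line_moment P a n \<le> K * real n powr (- \<beta>)"
    using line_moment_decay[OF \<open>P \<noteq> 0\<close>, of j] assms(2) unfolding j \<beta>' by blast
  have torus: "torus_moment P n \<le> K * real n powr (- \<beta>)" if "n \<ge> 1" for n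
    using torus_moment_decay[OF line that] .
  \<comment> \<open>Positivity of \<open>\<delta>\<close> makes the series for
    \<open>\<zeta>\<close> converge, \<open>\<delta> < \<beta>\<close> keeps the exponent
    \<open>- \<beta> + \<delta>\<close> negative, and \<open>\<delta> \<le> \<epsilon>\<close>
    allows the return to \<open>\<epsilon>\<close> at the end.\<close>
  define \<delta> where "\<delta> = min \<epsilon> (\<beta> / 2)"
  have \<delta>: "\<delta> > 0" "\<delta> \<le> \<epsilon>" "\<delta> < \<beta>" using \<beta> \<open>\<epsilon> > 0\<close> by (auto simp: \<delta>_def)
  define \<zeta> where "\<zeta> = suminf (\<lambda>n. real (Suc n) powr (- 1 - \<delta>))"
  have sum_\<zeta>: "summable (\<lambda>n. real (Suc n) powr (- 1 - \<delta>))"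
    using \<delta> by (subst summable_Suc_iff) (simp add: summable_real_powr_iff)
  have \<zeta>: "\<zeta> \<ge> 0" unfolding \<zeta>_def by (intro suminf_nonneg sum_\<zeta>) simp
  \<comment> \<open>Moments of order \<open>n \<ge> 1\<close> agree as soon as
    \<open>real n * E \<le> rho a\<close>; the summand 1 supplies the strict inequality.
    \<open>E\<close> also serves as the threshold \<open>R\<close>.\<close>
  define E where "E = 2 * real_of_int (key_bound P) + 1"
  have E: "E \<ge> 1" using key_bound_nonneg[of P] by (simp add: E_def)
  define C where "C = K * E powr (\<beta> - \<delta>) * \<zeta>"
  have C: "C \<ge> 0" using K \<zeta> by (simp add: C_def)
  have main: "ereal \<bar>mahler (monomial_subst a P) - mahler P\<bar> \<le> ereal C * ereal_powr (rho a) (- \<beta> + \<epsilon>)"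
    if a: "rho a \<ge> ereal E" for a
  proof -
    have "ereal (of_int (2 * key_bound P)) < ereal E" by (simp add: E_def)
    then have "ereal (of_int (2 * key_bound P)) < rho a"
      using a by (rule less_le_trans)
    then have inj: "inj_on (\<lambda>\<omega>. int_dot \<omega> a) (Poly_Mapping.keys P)"
      by (rule inj_on_int_dot)
    then have line_a: "line_moment P a n \<le> K * real n powr (- \<beta>)" if "n \<ge> 1" for n
      using line that by blast
    note T = mahler_torus_series[OF \<open>P \<noteq> 0\<close> \<beta> torus]
    note L = mahler_line_series[OF \<open>P \<noteq> 0\<close> \<beta> line_a]
    define d where "d n = (torus_moment P (Suc n) - line_moment P a (Suc n)) / Suc n" for n
    have d_sum: "summable d"
      unfolding d_def diff_divide_distrib by (intro summable_diff T L)
    have diff: "mahler (monomial_subst a P) - mahler P = suminf d / 2"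
    proof -
      have "suminf d = suminf (\<lambda>n. torus_moment P (Suc n) / Suc n)
          - suminf (\<lambda>n. line_moment P a (Suc n) / Suc n)"
        unfolding d_def diff_divide_distrib by (rule suminf_diff[OF T(1) L(1), symmetric])
      then show ?thesis using L(2) T(2) by (simp add: field_simps)
    qed
    \<comment> \<open>The index is shifted: \<open>d n\<close> compares the moments of order
      \<open>Suc n\<close>.\<close>
    have agree: "d n = 0" if "ereal (real (Suc n) * E) \<le> rho a" for n
    proof -
      have "real_of_int (int (Suc n) * (2 * key_bound P)) < real (Suc n) * E"
        by (simp add: E_def)
      then have "ereal (of_int (int (Suc n) * (2 * key_bound P))) < rho a"
        using that by (metis less_ereal.simps(1) less_le_trans)
      then show ?thesis by (simp add: d_def line_moment_eq_torus_moment)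
    qed
    show ?thesis
    proof (cases "rho a")
      case (real r)
      have r: "r \<ge> E" using a real by simp
      then have "r \<ge> 1" using E by simp
      \<comment> \<open>Only orders above \<open>r / E\<close> contribute. There part of the decay,
        \<open>real (Suc n) powr (- \<beta> + \<delta>)\<close>, is traded for the same power of
        \<open>r / E\<close>, and the remaining factor is summable.\<close>
      have d_le: "\<bar>d n\<bar> \<le> K * (r / E) powr (- \<beta> + \<delta>) * real (Suc n) powr (- 1 - \<delta>)" for n
      proof (cases "real (Suc n) * E \<le> r")
        case True
        then show ?thesis using agree[of n] real K by simp
      next
        case False
        then have "r / E \<le> real (Suc n)" using E by (simp add: field_simps)
        \<comment> \<open>Both moments lie between 0 and the same bound, so their difference needs
          no factor 2.\<close>
        have "\<bar>torus_moment P (Suc n) - line_moment P a (Suc n)\<bar> \<le> K * real (Suc n) powr (- \<beta>)"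
          using torus[of "Suc n"] line_a[of "Suc n"] torus_moment_nonneg[OF \<open>P \<noteq> 0\<close>, of "Suc n"]
            line_moment_nonneg[OF \<open>P \<noteq> 0\<close>, of a "Suc n"] by linarith
        then have "\<bar>d n\<bar> \<le> K * real (Suc n) powr (- \<beta>) / real (Suc n)"
          unfolding d_def abs_divide by (simp add: divide_right_mono)
        also have "\<dots> = K * (real (Suc n) powr (- \<beta> + \<delta>) * real (Suc n) powr (- 1 - \<delta>))"
        proof -
          have "real (Suc n) powr (- \<beta>) / real (Suc n) = real (Suc n) powr (- \<beta> - 1)"
            by (simp add: powr_diff)
          also have "\<dots> = real (Suc n) powr (- \<beta> + \<delta>) * real (Suc n) powr (- 1 - \<delta>)"
            by (simp flip: powr_add)
          finally show ?thesis by (metis times_divide_eq_right)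
        qed
        also have "\<dots> \<le> K * ((r / E) powr (- \<beta> + \<delta>) * real (Suc n) powr (- 1 - \<delta>))"
          using K \<delta> E r \<open>r / E \<le> real (Suc n)\<close>
          by (intro mult_left_mono mult_right_mono powr_mono2') auto
        finally show ?thesis by (simp only: mult.assoc)
      qed
      have "\<bar>suminf d\<bar> \<le> K * (r / E) powr (- \<beta> + \<delta>) * \<zeta>"
      proof -
        have s: "summable (\<lambda>n. K * (r / E) powr (- \<beta> + \<delta>) * real (Suc n) powr (- 1 - \<delta>))"
          by (intro summable_mult sum_\<zeta>)
        then have abs: "summable (\<lambda>n. \<bar>d n\<bar>)"
          using d_le by (intro summable_comparison_test'[OF s]) auto
        have "\<bar>suminf d\<bar> \<le> (suminf (\<lambda>n. \<bar>d n\<bar>))"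
          using summable_rabs[OF abs] .
        also have "\<dots> \<le> suminf (\<lambda>n. K * (r / E) powr (- \<beta> + \<delta>) * real (Suc n) powr (- 1 - \<delta>))"
          using d_le by (intro suminf_le abs s)
        also have "\<dots> = K * (r / E) powr (- \<beta> + \<delta>) * \<zeta>"
          unfolding \<zeta>_def by (rule suminf_mult[OF sum_\<zeta>])
        finally show ?thesis .
      qed
      also have "(r / E) powr (- \<beta> + \<delta>) = r powr (- \<beta> + \<delta>) * E powr (\<beta> - \<delta>)"
        using r E powr_minus_divide[of E "\<delta> - \<beta>"] by (simp add: powr_divide)
      also have "K * (r powr (- \<beta> + \<delta>) * E powr (\<beta> - \<delta>)) * \<zeta> = C * r powr (- \<beta> + \<delta>)"
        by (simp add: C_def)
      also have "\<dots> \<le> C * r powr (- \<beta> + \<epsilon>)"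
        using C \<delta> \<open>r \<ge> 1\<close> by (intro mult_left_mono powr_mono) auto
      finally have "\<bar>suminf d\<bar> \<le> C * r powr (- \<beta> + \<epsilon>)" .
      then have "\<bar>suminf d / 2\<bar> \<le> C * r powr (- \<beta> + \<epsilon>)" by linarith
      then show ?thesis
        unfolding diff real by (simp add: ereal_powr_def)
    next
      case PInf
      \<comment> \<open>With no non-zero relation all moments agree, and the two Mahler measures
        coincide.\<close>
      then have "d = (\<lambda>n. 0)" using agree by (simp add: fun_eq_iff)
      then have "ereal \<bar>mahler (monomial_subst a P) - mahler P\<bar> = 0" using diff by simp
      also have "0 \<le> ereal C * ereal_powr (rho a) (- \<beta> + \<epsilon>)"
        unfolding PInf using C by (intro ereal_0_le_mult ereal_powr_PInf_nonneg) simp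
      finally show ?thesis .
    next
      case MInf
      then show ?thesis using a by simp
    qed
  qed
  show ?thesis
    using main unfolding \<beta>_def by blast
qed

end
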